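(* Let $R$ be a commutative Noetherian ring, $N \subseteq M$ finitely generated $R$-modules, $X \subseteq \mathrm{Spec}(R)$ a basic set, and $\mathscr{E}$ an $R$-submodule of $\mathrm{Hom}_R(M,R)$. Assume that for each $\mathfrak{p} \in X$, $N_\mathfrak{p}$ contains a free $R_\mathfrak{p}$-submodule $F(\mathfrak{p})$ of rank at least $1 + \dim_X(\mathfrak{p})$ that is a free $\mathscr{E}_\mathfrak{p}$-summand of $M_\mathfrak{p}$. Then there exists $x \in N$ that is $X$-free-basic for $M$ with respect to $\mathscr{E}$. Moreover, if an element $(a,y) \in R \oplus N$ is $X$-free-basic for $R \oplus M$ with respect to $R \oplus \mathscr{E}$, then $x$ can be chosen of the form $x = y + az$ for some $z \in N$.
   Context: A subset $X \subseteq \mathrm{Spec}(R)$ is basic if, whenever the intersection of a family of primes in $X$ is a prime ideal, that intersection belongs to $X$. For $\mathfrak{p} \in X$, $\dim_X(\mathfrak{p})$ is the supremum of the lengths $n$ of chains $\mathfrak{p} = \mathfrak{p}_0 \subsetneq \cdots \subsetneq \mathfrak{p}_n$ in $X$. For an $R$-submodule $\mathscr{E} \subseteq \mathrm{Hom}_R(M,R)$, $\mathscr{E}_\mathfrak{p}$ is viewed inside $\mathrm{Hom}_{R_\mathfrak{p}}(M_\mathfrak{p},R_\mathfrak{p})$. A free $\mathscr{E}_\mathfrak{p}$-summand of $M_\mathfrak{p}$ is a direct summand $F$ of $M_\mathfrak{p}$ (with complement $G$) with $F \cong R_\mathfrak{p}^n$ such that each coordinate of the projection $M_\mathfrak{p}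 \to F \cong R_\mathfrak{p}^n$ along $G$ lies in $\mathscr{E}_\mathfrak{p}$. An element $x \in M$ is $\mathfrak{p}$-free-basic for $M$ with respect to $\mathscr{E}$ if $(Rx)_\mathfrak{p} \cong R_\mathfrak{p}$ and the inclusion $(Rx)_\mathfrak{p} \subseteq M_\mathfrak{p}$ splits via an element of $\mathscr{E}_\mathfrak{p}$ (i.e. some $\varphi \in \mathscr{E}_\mathfrak{p}$ has $\varphi(x/1) = 1$); it is $X$-free-basic with respect to $\mathscr{E}$ if it is $\mathfrak{p}$-free-basic with respect to $\mathscr{E}$ for every $\mathfrak{p} \in X$. Here $R \oplus \mathscr{E}$ is regarded as the $R$-submodule of $\mathrm{Hom}_R(R \oplus M, R)$ consisting of the maps $(r,m) \mapsto cr + f(m)$ with $c \in R$, $f \in \mathscr{E}$. *)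

theory Defs
  imports Main "HOL-Library.Product_Plus" "HOL-Library.Extended_Nat"
begin

definition ring_ideal :: "'r::comm_ring_1 set \<Rightarrow> bool" where
  "ring_ideal I \<longleftrightarrow> 0 \<in> I \<and> (\<forall>a\<in>I. \<forall>b\<in>I. a + b \<in> I) \<and> (\<forall>r. \<forall>a\<in>I. r * a \<in> I)"

definition prime_ideal :: "'r::comm_ring_1 set \<Rightarrow> bool" where
  "prime_ideal P \<longleftrightarrow> ring_ideal P \<and> P \<noteq> UNIV \<and> (\<forall>a b. a * b \<in> P \<longrightarrow> a \<in> P \<or> b \<in> P)"

definition Spec :: "'r::comm_ring_1 set set" where
  "Spec = {P. prime_ideal P}"

definition noetherian_ring :: "'r::comm_ring_1 itself \<Rightarrow> bool" where
  "noetherian_ring _ \<longleftrightarrow>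
     (\<forall>I::'r set. ring_ideal I \<longrightarrow> (\<exists>S. finite S \<and> module.span ((*)) S = I))"

definition basic_set :: "'r::comm_ring_1 set set \<Rightarrow> bool" where
  "basic_set X \<longleftrightarrow> X \<subseteq> Spec \<and> (\<forall>Y. Y \<subseteq> X \<and> \<Inter>Y \<in> Spec \<longrightarrow> \<Inter>Y \<in> X)"

definition dimX :: "'r set set \<Rightarrow> 'r set \<Rightarrow> enat" where
  "dimX X p = Sup {enat n | n. \<exists>c. c 0 = p \<and> (\<forall>i\<le>n. c i \<in> X) \<and> (\<forall>i<n. c i \<subset> c (Suc i))}"

definition r_hom :: "('r::comm_ring_1 \<Rightarrow> 'm::ab_group_add \<Rightarrow> 'm) \<Rightarrow> ('m \<Rightarrow> 'r) \<Rightarrow> bool" where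
  "r_hom sc f \<longleftrightarrow> (\<forall>x y. f (x + y) = f x + f y) \<and> (\<forall>r x. f (sc r x) = r * f x)"

definition hom_submodule :: "('r::comm_ring_1 \<Rightarrow> 'm::ab_group_add \<Rightarrow> 'm) \<Rightarrow> ('m \<Rightarrow> 'r) set \<Rightarrow> bool" where
  "hom_submodule sc E \<longleftrightarrow> E \<subseteq> {f. r_hom sc f} \<and> (\<lambda>_. 0) \<in> E \<and>
     (\<forall>f\<in>E. \<forall>g\<in>E. (\<lambda>x. f x + g x) \<in> E) \<and> (\<forall>r. \<forall>f\<in>E. (\<lambda>x. r * f x) \<in> E)"

definition frac_rel :: "('r::comm_ring_1 \<Rightarrow> 'm::ab_group_add \<Rightarrow> 'm) \<Rightarrow> 'r set \<Rightarrow> (('m \<times> 'r) \<times> ('m \<times> 'r)) set" where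
  "frac_rel sc p = {((m, s), (m', s')). s \<notin> p \<and> s' \<notin> p \<and>
      (\<exists>u. u \<notin> p \<and> sc u (sc s' m - sc s m') = 0)}"

definition frac :: "('r::comm_ring_1 \<Rightarrow> 'm::ab_group_add \<Rightarrow> 'm) \<Rightarrow> 'r set \<Rightarrow> 'm \<Rightarrow> 'r \<Rightarrow> ('m \<times> 'r) set" where
  "frac sc p m s = frac_rel sc p `` {(m, s)}"

definition Mloc :: "('r::comm_ring_1 \<Rightarrow> 'm::ab_group_add \<Rightarrow> 'm) \<Rightarrow> 'r set \<Rightarrow> 'm set \<Rightarrow> ('m \<times> 'r) set set" where
  "Mloc sc p S = {frac sc p m s | m s. m \<in> S \<and> s \<notin> p}"

abbreviation Rloc :: "'r::comm_ring_1 set \<Rightarrow> ('r \<times> 'r) set set" where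
  "Rloc p \<equiv> Mloc ((*)) p UNIV"

definition loc_add :: "('r::comm_ring_1 \<Rightarrow> 'm::ab_group_add \<Rightarrow> 'm) \<Rightarrow> 'r set \<Rightarrow> ('m \<times> 'r) set \<Rightarrow> ('m \<times> 'r) set \<Rightarrow> ('m \<times> 'r) set" where
  "loc_add sc p a b = (THE c. \<exists>m s m' s'. s \<notin> p \<and> s' \<notin> p \<and> a = frac sc p m s \<and> b = frac sc p m' s'
       \<and> c = frac sc p (sc s' m + sc s m') (s * s'))"

definition loc_smult :: "('r::comm_ring_1 \<Rightarrow> 'm::ab_group_add \<Rightarrow> 'm) \<Rightarrow> 'r set \<Rightarrow> ('r \<times> 'r) set \<Rightarrow> ('m \<times> 'r) set \<Rightarrow> ('m \<times> 'r) set" where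
  "loc_smult sc p r a = (THE c. \<exists>c0 u m s. u \<notin> p \<and> s \<notin> p \<and> r = frac ((*)) p c0 u \<and> a = frac sc p m s
       \<and> c = frac sc p (sc c0 m) (u * s))"

definition loc_zero :: "('r::comm_ring_1 \<Rightarrow> 'm::ab_group_add \<Rightarrow> 'm) \<Rightarrow> 'r set \<Rightarrow> ('m \<times> 'r) set" where
  "loc_zero sc p = frac sc p 0 1"

definition loc_one :: "'r::comm_ring_1 set \<Rightarrow> ('r \<times> 'r) set" where
  "loc_one p = frac ((*)) p 1 1"

definition loc_submodule :: "('r::comm_ring_1 \<Rightarrow> 'm::ab_group_add \<Rightarrow> 'm) \<Rightarrow> 'r set \<Rightarrow> ('m \<times> 'r) set set \<Rightarrow> bool" where
  "loc_submodule sc p S \<longleftrightarrow> S \<subseteq> Mloc sc p UNIV \<and> loc_zero sc p \<in> S \<and>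
     (\<forall>a\<in>S. \<forall>b\<in>S. loc_add sc p a b \<in> S) \<and> (\<forall>r\<in>Rloc p. \<forall>a\<in>S. loc_smult sc p r a \<in> S)"

definition loc_linear :: "('r::comm_ring_1 \<Rightarrow> 'm::ab_group_add \<Rightarrow> 'm) \<Rightarrow> ('r \<Rightarrow> 'n::ab_group_add \<Rightarrow> 'n) \<Rightarrow> 'r set
     \<Rightarrow> ('m \<times> 'r) set set \<Rightarrow> (('m \<times> 'r) set \<Rightarrow> ('n \<times> 'r) set) \<Rightarrow> bool" where
  "loc_linear sc1 sc2 p S f \<longleftrightarrow>
     (\<forall>a\<in>S. \<forall>b\<in>S. f (loc_add sc1 p a b) = loc_add sc2 p (f a) (f b)) \<and>
     (\<forall>r\<in>Rloc p. \<forall>a\<in>S. f (loc_smult sc1 p r a) = loc_smult sc2 p r (f a))"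

definition Rpow :: "'r::comm_ring_1 set \<Rightarrow> nat \<Rightarrow> (nat \<Rightarrow> ('r \<times> 'r) set) set" where
  "Rpow p n = {v. (\<forall>i<n. v i \<in> Rloc p) \<and> (\<forall>i\<ge>n. v i = loc_zero ((*)) p)}"

text \<open>E_p, viewed inside Hom_{R_p}(M_p,R_p): phi/s acts by m/t |-> phi(m)/(st).\<close>
definition loc_map :: "('r::comm_ring_1 \<Rightarrow> 'm::ab_group_add \<Rightarrow> 'm) \<Rightarrow> 'r set \<Rightarrow> ('m \<Rightarrow> 'r) \<Rightarrow> 'r
     \<Rightarrow> ('m \<times> 'r) set \<Rightarrow> ('r \<times> 'r) set" where
  "loc_map sc p \<phi> s = (\<lambda>v. if v \<in> Mloc sc p UNIV
       then (THE c. \<exists>m t. t \<notin> p \<and> v = frac sc p m t \<and> c = frac ((*)) p (\<phi> m) (s * t))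
       else undefined)"

definition Eloc :: "('r::comm_ring_1 \<Rightarrow> 'm::ab_group_add \<Rightarrow> 'm) \<Rightarrow> 'r set \<Rightarrow> ('m \<Rightarrow> 'r) set
     \<Rightarrow> (('m \<times> 'r) set \<Rightarrow> ('r \<times> 'r) set) set" where
  "Eloc sc p E = {loc_map sc p \<phi> s | \<phi> s. \<phi> \<in> E \<and> s \<notin> p}"

definition summand_proj :: "('r::comm_ring_1 \<Rightarrow> 'm::ab_group_add \<Rightarrow> 'm) \<Rightarrow> 'r set \<Rightarrow> ('m \<times> 'r) set set
     \<Rightarrow> ('m \<times> 'r) set set \<Rightarrow> ('m \<times> 'r) set \<Rightarrow> ('m \<times> 'r) set" where
  "summand_proj sc p F G v = (THE f. f \<in> F \<and> (\<exists>g\<in>G. v = loc_add sc p f g))"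

definition free_E_summand :: "('r::comm_ring_1 \<Rightarrow> 'm::ab_group_add \<Rightarrow> 'm) \<Rightarrow> 'r set \<Rightarrow> ('m \<Rightarrow> 'r) set
     \<Rightarrow> ('m \<times> 'r) set set \<Rightarrow> nat \<Rightarrow> bool" where
  "free_E_summand sc p E F n \<longleftrightarrow> loc_submodule sc p F \<and>
     (\<exists>G. loc_submodule sc p G \<and> F \<inter> G = {loc_zero sc p} \<and>
        (\<forall>v\<in>Mloc sc p UNIV. \<exists>f\<in>F. \<exists>g\<in>G. v = loc_add sc p f g) \<and>
        (\<exists>\<psi>. bij_betw \<psi> F (Rpow p n) \<and> (\<forall>i<n. loc_linear sc ((*)) p F (\<lambda>v. \<psi> v i)) \<and>
             (\<forall>i<n. (\<lambda>v. if v \<in> Mloc sc p UNIV then \<psi> (summand_proj sc p F G v) i else undefined)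
                      \<in> Eloc sc p E)))"

definition p_free_basic :: "('r::comm_ring_1 \<Rightarrow> 'm::ab_group_add \<Rightarrow> 'm) \<Rightarrow> 'r set \<Rightarrow> ('m \<Rightarrow> 'r) set \<Rightarrow> 'm \<Rightarrow> bool" where
  "p_free_basic sc p E x \<longleftrightarrow>
     (\<exists>\<psi>. bij_betw \<psi> (Mloc sc p (range (\<lambda>r. sc r x))) (Rloc p) \<and>
          loc_linear sc ((*)) p (Mloc sc p (range (\<lambda>r. sc r x))) \<psi>) \<and>
     (\<exists>\<phi>\<in>Eloc sc p E. \<phi> (frac sc p x 1) = loc_one p)"

definition X_free_basic :: "('r::comm_ring_1 \<Rightarrow> 'm::ab_group_add \<Rightarrow> 'm) \<Rightarrow> 'r set set \<Rightarrow> ('m \<Rightarrow> 'r) set \<Rightarrow> 'm \<Rightarrow> bool" where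
  "X_free_basic sc X E x \<longleftrightarrow> (\<forall>p\<in>X. p_free_basic sc p E x)"

definition sum_scale :: "('r::comm_ring_1 \<Rightarrow> 'm::ab_group_add \<Rightarrow> 'm) \<Rightarrow> 'r \<Rightarrow> 'r \<times> 'm \<Rightarrow> 'r \<times> 'm" where
  "sum_scale sc r v = (r * fst v, sc r (snd v))"

definition sum_E :: "('m \<Rightarrow> 'r::comm_ring_1) set \<Rightarrow> ('r \<times> 'm \<Rightarrow> 'r) set" where
  "sum_E E = {(\<lambda>v. c * fst v + f (snd v)) | c f. f \<in> E}"

end

theory Submission
  imports Defs
begin

text \<open>The argument follows Eisenbud and Evans. An element \<open>x\<close> is \<open>p\<close>-free-basic iff some
  \<open>\<phi> \<in> E\<close> has \<open>\<phi> x \<notin> p\<close>, and the hypothesis says that the image of \<open>N\<close> in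
  \<open>Hom\<^sub>R(E, \<kappa>(p))\<close> has rank at least \<open>d(p) = 1 + dim\<^sub>X p\<close>. Start with \<open>x\<^sub>0 = y\<close> and generators
  \<open>x\<^sub>1, \<dots>, x\<^sub>k\<close> of \<open>N\<close>, and keep the invariant that the current \<open>k + 1\<close> elements have rank at least
  \<open>min (k + 1) (d(p))\<close> at every \<open>p \<in> X\<close> while eliminating \<open>x\<^sub>k\<close>: replace \<open>x\<^sub>0\<close> by
  \<open>x\<^sub>0 + a b\<^sub>0 x\<^sub>k\<close> and \<open>x\<^sub>i\<close> by \<open>x\<^sub>i + b\<^sub>i x\<^sub>k\<close>. The rank drops by at most one. At a prime \<open>p\<close> of rank
  \<open>t \<le> k\<close> that strictly contains another \<open>q \<in> X\<close> of rank at most \<open>t\<close>, the invariant at \<open>q\<close> gives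
  \<open>d(p) < d(q) \<le> t\<close>, so a drop is harmless; since \<open>X\<close> is basic and \<open>R\<close> is Noetherian, only finitely
  many primes of rank at most \<open>k\<close> remain, and at those the \<open>b\<^sub>i\<close> can be chosen so that the rank
  does not drop. The first assertion is the case \<open>a = 1\<close>, \<open>y = 0\<close>.\<close>

subsection \<open>Prime ideals\<close>

lemma prime_ideal_zero: "prime_ideal p \<Longrightarrow> 0 \<in> p"
  by (simp add: prime_ideal_def ring_ideal_def)

lemma prime_ideal_add: "prime_ideal p \<Longrightarrow> a \<in> p \<Longrightarrow> b \<in> p \<Longrightarrow> a + b \<in> p"
  by (simp add: prime_ideal_def ring_ideal_def)

lemma prime_ideal_mult: "prime_ideal p \<Longrightarrow> a \<in> p \<or> b \<in> p \<Longrightarrow> a * b \<in> p"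
  unfolding prime_ideal_def ring_ideal_def by (metis mult.commute)

lemma prime_ideal_mult_iff: "prime_ideal p \<Longrightarrow> a * b \<in> p \<longleftrightarrow> a \<in> p \<or> b \<in> p"
  using prime_ideal_mult unfolding prime_ideal_def by blast

lemma prime_ideal_uminus: "prime_ideal p \<Longrightarrow> a \<in> p \<Longrightarrow> - a \<in> p"
  using prime_ideal_mult[of p a "-1"] by simp

lemma prime_ideal_diff: "prime_ideal p \<Longrightarrow> a \<in> p \<Longrightarrow> b \<in> p \<Longrightarrow> a - b \<in> p"
  using prime_ideal_add[of p a "- b"] prime_ideal_uminus by force

lemma prime_ideal_one: "prime_ideal p \<Longrightarrow> 1 \<notin> p"
  using prime_ideal_mult[of p 1] unfolding prime_ideal_def by auto

lemma prime_ideal_sum: "prime_ideal p \<Longrightarrow> (\<And>i. i \<in> I \<Longrightarrow> f i \<in> p) \<Longrightarrow> sum f I \<in> p"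
  by (induction I rule: infinite_finite_induct) (auto intro: prime_ideal_zero prime_ideal_add)

lemma prime_ideal_cong: "prime_ideal p \<Longrightarrow> a - b \<in> p \<Longrightarrow> a \<in> p \<longleftrightarrow> b \<in> p"
  using prime_ideal_add[of p "a - b" b] prime_ideal_diff[of p a "a - b"] by auto

lemma prime_ideal_prod_notin:
  "finite I \<Longrightarrow> prime_ideal p \<Longrightarrow> (\<And>i. i \<in> I \<Longrightarrow> f i \<notin> p) \<Longrightarrow> prod f I \<notin> p"
  by (induction I rule: finite_induct) (auto simp: prime_ideal_one prime_ideal_mult_iff)

lemma prime_ideal_prod: "prime_ideal p \<Longrightarrow> finite I \<Longrightarrow> i \<in> I \<Longrightarrow> f i \<in> p \<Longrightarrow> prod f I \<in> p"
  by (metis prime_ideal_mult prod.remove)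

section \<open>Ideals of a Noetherian ring and lower bounds for families of primes\<close>

lemma ring_ideal_Inter: "(\<And>p. p \<in> Z \<Longrightarrow> ring_ideal p) \<Longrightarrow> ring_ideal (\<Inter>Z)"
  unfolding ring_ideal_def by blast

lemma module_mult: "module ((*) :: 'r::comm_ring_1 \<Rightarrow> 'r \<Rightarrow> 'r)"
  by unfold_locales (auto simp: algebra_simps)

text \<open>The union of an ascending chain of ideals has finitely many generators; they all lie in
  one member, where the chain stops.\<close>

lemma wf_ideal_supset:
  assumes "noetherian_ring TYPE('r::comm_ring_1)"
  shows "wf {(J, I :: 'r set). ring_ideal I \<and> ring_ideal J \<and> I \<subset> J}"
  unfolding wf_iff_no_infinite_down_chain
proof
  assume "\<exists>f. \<forall>i. (f (Suc i), f i) \<in> {(J, I :: 'r set). ring_ideal I \<and> ring_ideal J \<and> I \<subset> J}"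
  then obtain f where f: "\<And>i. ring_ideal (f i :: 'r set)" "\<And>i. f i \<subset> f (Suc i)" by simp blast
  have mono: "f i \<subseteq> f j" if "i \<le> j" for i j
    using lift_Suc_mono_le[of f i j] f(2) that by blast
  have "ring_ideal (\<Union>i. f i)"
    unfolding ring_ideal_def
  proof (intro conjI ballI allI)
    show "0 \<in> (\<Union>i. f i)" using f(1) by (auto simp: ring_ideal_def)
  next
    fix a b assume "a \<in> (\<Union>i. f i)" "b \<in> (\<Union>i. f i)"
    then obtain i j where "a \<in> f i" "b \<in> f j" by blast
    then have "a \<in> f (max i j)" "b \<in> f (max i j)" using mono by (meson max.cobounded1 max.cobounded2 subsetD)+
    then show "a + b \<in> (\<Union>i. f i)" using f(1)[of "max i j"] by (auto simp: ring_ideal_def)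
  next
    fix r a assume "a \<in> (\<Union>i. f i)"
    then obtain i where i: "a \<in> f i" by blast
    then have "r * a \<in> f i" using f(1)[of i] by (simp add: ring_ideal_def)
    then show "r * a \<in> (\<Union>i. f i)" by blast
  qed
  then obtain S where S: "finite S" "module.span ((*)) S = (\<Union>i. f i)"
    using assms[unfolded noetherian_ring_def, THEN spec, of "\<Union>i. f i"] by auto
  interpret R: module "(*) :: 'r \<Rightarrow> 'r \<Rightarrow> 'r" by (rule module_mult)
  have "S \<subseteq> (\<Union>i. f i)" using S(2) R.span_superset by blast
  then obtain n where n: "S \<subseteq> f n"
  proof -
    have "\<exists>n. S \<subseteq> f n" using \<open>finite S\<close> \<open>S \<subseteq> (\<Union>i. f i)\<close>
    proof (induction S rule: finite_induct)
      case (insert x F)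
      then obtain n m where "F \<subseteq> f n" "x \<in> f m" by auto
      then have "insert x F \<subseteq> f (max n m)" using mono[of n "max n m"] mono[of m "max n m"] by auto
      then show ?case by blast
    qed simp
    then show ?thesis using that by blast
  qed
  have "R.subspace (f n)" using f(1)[of n] unfolding ring_ideal_def R.subspace_def by blast
  then have "(\<Union>i. f i) \<subseteq> f n" using R.span_minimal[OF n] S(2) by simp
  then show False using f(2)[of n] by blast
qed

text \<open>Noetherian induction on the intersection of \<open>Z\<close>: unless that intersection is prime,
  some \<open>a * b\<close> in it with neither factor in it splits \<open>Z\<close> into two parts with larger intersections.\<close>

lemma finite_lower_primes:
  fixes Y :: "'r::comm_ring_1 set set"
  assumes noeth: "noetherian_ring TYPE('r)"
    and Y: "\<And>p. p \<in> Y \<Longrightarrow> prime_ideal p"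
    and closed: "\<And>Z. Z \<subseteq> Y \<Longrightarrow> prime_ideal (\<Inter>Z) \<Longrightarrow> \<Inter>Z \<in> Y"
  shows "\<exists>F. finite F \<and> F \<subseteq> Y \<and> (\<forall>p\<in>Y. \<exists>q\<in>F. q \<subseteq> p)"
proof -
  \<comment> \<open>\<open>F\<close> is sought in \<open>Y\<close>, not in \<open>Z\<close>: a prime
    \<open>\<Inter>Z\<close> serves as a single lower bound, and closedness places it in
    \<open>Y\<close> only.\<close>
  have "\<forall>Z. Z \<subseteq> Y \<longrightarrow> \<Inter>Z = I \<longrightarrow> (\<exists>F. finite F \<and> F \<subseteq> Y \<and> (\<forall>p\<in>Z. \<exists>q\<in>F. q \<subseteq> p))" for I
  proof (induction I rule: wf_induct_rule[OF wf_ideal_supset[OF noeth]])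
    case (1 I)
    show ?case
    proof (intro allI impI)
      fix Z assume Z: "Z \<subseteq> Y" "\<Inter>Z = I"
      have ideal: "ring_ideal (\<Inter>W)" if "W \<subseteq> Y" for W
        using that Y by (intro ring_ideal_Inter) (auto simp: prime_ideal_def)
      show "\<exists>F. finite F \<and> F \<subseteq> Y \<and> (\<forall>p\<in>Z. \<exists>q\<in>F. q \<subseteq> p)"
      proof (cases "prime_ideal I \<or> Z = {}")
        case True
        then show ?thesis
        proof
          assume "prime_ideal I"
          then have "I \<in> Y" using closed Z by blast
          then show ?thesis using Z by (intro exI[of _ "{I}"]) auto
        qed (auto intro: exI[of _ "{}"])
      next
        case False
        have "1 \<notin> I" using False Z Y prime_ideal_one by blast
        then obtain a b where ab: "a * b \<in> I" "a \<notin> I" "b \<notin> I"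
          using False ideal[OF Z(1)] Z(2) unfolding prime_ideal_def by blast
        have part: "\<exists>F. finite F \<and> F \<subseteq> Y \<and> (\<forall>p\<in>{p \<in> Z. c \<in> p}. \<exists>q\<in>F. q \<subseteq> p)" if "c \<notin> I" for c
        proof -
          have sub: "{p \<in> Z. c \<in> p} \<subseteq> Y" using Z by blast
          have "I \<subset> \<Inter>{p \<in> Z. c \<in> p}" using Z(2) that by blast
          then have "(\<Inter>{p \<in> Z. c \<in> p}, I) \<in> {(J, I). ring_ideal I \<and> ring_ideal J \<and> I \<subset> J}"
            using ideal[OF sub] ideal[OF Z(1)] Z(2) by simp
          then show ?thesis by (rule 1[THEN spec, THEN mp, OF _ sub, THEN mp, OF _ refl])
        qed
        obtain F where F: "finite F" "F \<subseteq> Y" "\<forall>p\<in>{p \<in> Z. a \<in> p}. \<exists>q\<in>F. q \<subseteq> p"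
          using part[OF ab(2)] by blast
        obtain G where G: "finite G" "G \<subseteq> Y" "\<forall>p\<in>{p \<in> Z. b \<in> p}. \<exists>q\<in>G. q \<subseteq> p"
          using part[OF ab(3)] by blast
        have split: "a \<in> p \<or> b \<in> p" if "p \<in> Z" for p
        proof -
          have "prime_ideal p" "a * b \<in> p" using that ab(1) Z Y by auto
          then show ?thesis by (simp add: prime_ideal_mult_iff)
        qed
        have "\<exists>q\<in>F \<union> G. q \<subseteq> p" if "p \<in> Z" for p
          using split[OF that] F(3)[THEN bspec, of p] G(3)[THEN bspec, of p] that
          by auto
        then show ?thesis using F(1,2) G(1,2) by (intro exI[of _ "F \<union> G"]) simp
      qed
    qed
  qed
  then show ?thesis by blast
qed

text \<open>A prime that is minimal in \<open>B\<close> is treated last: it does not contain the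
  product of suitable elements of the other primes, so a correction at it by a multiple of this
  product does not disturb them.\<close>

lemma simultaneous_choice:
  fixes B :: "'r::comm_ring_1 set set" and G :: "'r set \<Rightarrow> ('i \<Rightarrow> 'r) \<Rightarrow> bool"
  assumes "finite B" and "\<And>p. p \<in> B \<Longrightarrow> prime_ideal p"
    and "\<And>p b b'. p \<in> B \<Longrightarrow> G p b \<Longrightarrow> (\<And>i. b' i - b i \<in> p) \<Longrightarrow> G p b'"
    and "\<And>p b r. p \<in> B \<Longrightarrow> r \<notin> p \<Longrightarrow> G p b \<or> (\<exists>j. G p (b(j := b j + r)))"
  shows "\<exists>b. \<forall>p\<in>B. G p b"
  using assms
proof (induction "card B" arbitrary: B)
  case 0
  then show ?case by simp
next
  case (Suc n)
  have "B \<noteq> {}" using Suc.hyps(2) by auto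
  then obtain p where p: "p \<in> B" "\<And>q. q \<in> B \<Longrightarrow> q \<subseteq> p \<Longrightarrow> q = p"
    using finite_has_minimal[OF Suc.prems(1)] by metis
  have card: "n = card (B - {p})" using Suc.hyps(2) p(1) Suc.prems(1) by simp
  have fin: "finite (B - {p})" using Suc.prems(1) by simp
  have "\<exists>b. \<forall>q\<in>B - {p}. G q b"
    by (rule Suc.hyps(1)[OF card fin]) (use Suc.prems in blast)+
  then obtain b where b: "\<And>q. q \<in> B - {p} \<Longrightarrow> G q b" by blast
  have "\<exists>r. r \<in> q - p" if "q \<in> B - {p}" for q using that p(2) by blast
  then obtain f where f: "\<And>q. q \<in> B - {p} \<Longrightarrow> f q \<in> q - p" by metis
  define r where "r = prod f (B - {p})"
  have r: "r \<notin> p" unfolding r_def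
    by (rule prime_ideal_prod_notin) (use Suc.prems p f in auto)
  have rq: "r \<in> q" if "q \<in> B - {p}" for q unfolding r_def
    by (rule prime_ideal_prod[OF _ fin that]) (use Suc.prems that f in auto)
  from Suc.prems(4)[OF p(1) r, of b] show ?case
  proof
    assume "G p b" then show ?thesis using b by blast
  next
    assume "\<exists>j. G p (b(j := b j + r))"
    then obtain j where j: "G p (b(j := b j + r))" by blast
    have "G q (b(j := b j + r))" if "q \<in> B - {p}" for q
      by (rule Suc.prems(3)[OF _ b[OF that]])
        (use that rq Suc.prems(2) prime_ideal_zero in auto)
    then show ?thesis using j by blast
  qed
qed

subsection \<open>The rank of a set of module elements at a prime\<close>

text \<open>For a submodule \<open>S\<close>, \<open>rank_ge E p t S\<close> says that the image of \<open>S\<close> in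
  \<open>Hom\<^sub>R(E, \<kappa>(p))\<close> spans a \<open>\<kappa>(p)\<close>-vector space of dimension at least \<open>t\<close>: each step
  splits off one dimension by a functional and passes to its kernel.\<close>

primrec rank_ge :: "('m \<Rightarrow> 'r) set \<Rightarrow> 'r set \<Rightarrow> nat \<Rightarrow> 'm set \<Rightarrow> bool" where
  "rank_ge E p 0 S \<longleftrightarrow> True"
| "rank_ge E p (Suc t) S \<longleftrightarrow> (\<exists>y\<in>S. \<exists>\<phi>\<in>E. \<phi> y \<notin> p \<and> rank_ge E p t {z\<in>S. \<phi> z \<in> p})"

section \<open>Monotonicity of the rank and its behaviour under specialization\<close>

lemma rank_ge_mono: "rank_ge E p t S \<Longrightarrow> S \<subseteq> T \<Longrightarrow> rank_ge E p t T"
proof (induction t arbitrary: S T)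
  case (Suc t)
  then obtain y \<phi> where y: "y \<in> S" "\<phi> \<in> E" "\<phi> y \<notin> p" "rank_ge E p t {z\<in>S. \<phi> z \<in> p}"
    by auto
  have "rank_ge E p t {z\<in>T. \<phi> z \<in> p}" by (rule Suc.IH[OF y(4)]) (use Suc.prems in auto)
  then show ?case using y Suc.prems by auto
qed simp

lemma rank_ge_Suc: "rank_ge E p (Suc t) S \<Longrightarrow> rank_ge E p t S"
proof (induction t arbitrary: S)
  case (Suc t)
  then obtain y \<phi> where "y \<in> S" "\<phi> \<in> E" "\<phi> y \<notin> p" "rank_ge E p (Suc t) {z\<in>S. \<phi> z \<in> p}"
    by (subst (asm) rank_ge.simps) blast
  moreover from this(4) have "rank_ge E p t {z\<in>S. \<phi> z \<in> p}" by (rule Suc.IH)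
  ultimately show ?case unfolding rank_ge.simps by blast
qed simp

lemma rank_ge_antimono: "rank_ge E p t S \<Longrightarrow> t' \<le> t \<Longrightarrow> rank_ge E p t' S"
proof (induction t)
  case (Suc t)
  then show ?case using rank_ge_Suc[OF Suc.prems(1)] by (cases "t' = Suc t") (simp_all del: rank_ge.simps)
qed simp

text \<open>Finitely many values outside \<open>q\<close> witness the rank, and \<open>s\<close> is
  their product. Kernels modulo \<open>q\<close> lie in the kernels modulo any larger
  \<open>p\<close>, so the same witnesses serve there if \<open>s\<close> avoids
  \<open>p\<close>.\<close>

lemma rank_ge_open:
  assumes q: "prime_ideal q" and rank: "rank_ge E q t S"
  shows "\<exists>s. s \<notin> q \<and> (\<forall>p. prime_ideal p \<longrightarrow> q \<subseteq> p \<longrightarrow> s \<notin> p \<longrightarrow> rank_ge E p t S)"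
  using rank
proof (induction t arbitrary: S)
  case 0
  then show ?case using prime_ideal_one[OF q] by auto
next
  case (Suc t)
  then obtain y \<phi> where y: "y \<in> S" "\<phi> \<in> E" "\<phi> y \<notin> q" "rank_ge E q t {z\<in>S. \<phi> z \<in> q}"
    by auto
  from Suc.IH[OF y(4)] obtain s where
    s: "s \<notin> q" "\<And>p. prime_ideal p \<Longrightarrow> q \<subseteq> p \<Longrightarrow> s \<notin> p \<Longrightarrow> rank_ge E p t {z\<in>S. \<phi> z \<in> q}"
    by blast
  have "rank_ge E p (Suc t) S" if p: "prime_ideal p" "q \<subseteq> p" "s * \<phi> y \<notin> p" for p
  proof -
    have "s \<notin> p" "\<phi> y \<notin> p" using p prime_ideal_mult by blast+
    moreover have "rank_ge E p t {z\<in>S. \<phi> z \<in> p}"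
      by (rule rank_ge_mono[OF s(2)[OF p(1,2)]]) (use calculation p in auto)
    ultimately show ?thesis using y by auto
  qed
  moreover have "s * \<phi> y \<notin> q" using s(1) y(3) prime_ideal_mult_iff[OF q] by blast
  ultimately show ?case by blast
qed

text \<open>Some member of \<open>Z\<close> misses the \<open>s\<close> of
  \<open>rank_ge_open\<close>. Hence the primes of small rank satisfy the closure condition of
  \<open>finite_lower_primes\<close>.\<close>

lemma rank_ge_Inter:
  assumes "prime_ideal (\<Inter>Z)" "\<And>p. p \<in> Z \<Longrightarrow> prime_ideal p" "rank_ge E (\<Inter>Z) t S"
  shows "\<exists>p\<in>Z. rank_ge E p t S"
  using rank_ge_open[OF assms(1,3)] assms(2) by blast

text \<open>Modulo \<open>p\<close> the matrix of the values \<open>\<phi> i (y j)\<close> is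
  diagonal with nonzero diagonal. Splitting off \<open>i\<close> leaves the other \<open>y j\<close>
  in the kernel of \<open>\<phi> i\<close>.\<close>

lemma rank_ge_dual_family:
  assumes "finite I" "\<And>i. i \<in> I \<Longrightarrow> \<phi> i \<in> E" "\<And>i. i \<in> I \<Longrightarrow> y i \<in> S"
    "\<And>i. i \<in> I \<Longrightarrow> \<phi> i (y i) \<notin> p" "\<And>i j. i \<in> I \<Longrightarrow> j \<in> I \<Longrightarrow> i \<noteq> j \<Longrightarrow> \<phi> i (y j) \<in> p"
  shows "rank_ge E p (card I) S"
  using assms
proof (induction I arbitrary: S rule: finite_induct)
  case (insert i I)
  have "rank_ge E p (card I) {z\<in>S. \<phi> i z \<in> p}"
  proof (rule insert.IH)
    fix j assume "j \<in> I"
    moreover have "i \<noteq> j" using calculation insert.hyps by blast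
    ultimately show "y j \<in> {z\<in>S. \<phi> i z \<in> p}" using insert.prems(2,4) by blast
  qed (use insert.prems in blast)+
  then show ?case using insert.hyps insert.prems(1-3)[of i] by auto
qed simp

locale module_functionals = module sc
  for sc :: "'r::comm_ring_1 \<Rightarrow> 'm::ab_group_add \<Rightarrow> 'm" +
  fixes E :: "('m \<Rightarrow> 'r) set"
  assumes E_hom: "\<phi> \<in> E \<Longrightarrow> r_hom sc \<phi>"
begin

section \<open>Evaluation of functionals and comparison of images modulo a prime\<close>

lemma E_add: "\<phi> \<in> E \<Longrightarrow> \<phi> (x + y) = \<phi> x + \<phi> y"
  and E_scale: "\<phi> \<in> E \<Longrightarrow> \<phi> (sc r x) = r * \<phi> x"
  using E_hom by (auto simp: r_hom_def)

lemma E_zero: "\<phi> \<in> E \<Longrightarrow> \<phi> 0 = 0"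
  using E_scale[of \<phi> 0 0] by simp

lemma E_diff: "\<phi> \<in> E \<Longrightarrow> \<phi> (x - y) = \<phi> x - \<phi> y"
  using E_add[of \<phi> "x - y" y] by simp

lemma E_sum: "\<phi> \<in> E \<Longrightarrow> \<phi> (sum f I) = (\<Sum>i\<in>I. \<phi> (f i))"
  by (induction I rule: infinite_finite_induct) (auto simp: E_zero E_add)

text \<open>This compares images in \<open>Hom(E, kappa(p))\<close> without forming the residue
  field: the factor \<open>c\<close>, nonzero modulo \<open>p\<close>, stands for a
  denominator.\<close>

definition dominated :: "'r set \<Rightarrow> 'm set \<Rightarrow> 'm set \<Rightarrow> bool" where
  "dominated p S T \<longleftrightarrow> (\<forall>z\<in>S. \<exists>c t. c \<notin> p \<and> t \<in> T \<and> (\<forall>\<phi>\<in>E. \<phi> (sc c z) - \<phi> t \<in> p))"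

lemma dominatedI:
  "(\<And>z. z \<in> S \<Longrightarrow> \<exists>c t. c \<notin> p \<and> t \<in> T \<and> (\<forall>\<phi>\<in>E. \<phi> (sc c z) - \<phi> t \<in> p)) \<Longrightarrow> dominated p S T"
  unfolding dominated_def by blast

text \<open>A functional vanishes modulo \<open>p\<close> on \<open>z\<close> exactly when it does
  on the element of \<open>T\<close> matched to \<open>z\<close>, so domination passes to
  kernels.\<close>

lemma rank_ge_dominated:
  assumes p: "prime_ideal p" and "dominated p S T" "rank_ge E p t S"
  shows "rank_ge E p t T"
  using assms(2,3)
proof (induction t arbitrary: S T)
  case (Suc t)
  then obtain y \<phi> where y: "y \<in> S" "\<phi> \<in> E" "\<phi> y \<notin> p" "rank_ge E p t {z\<in>S. \<phi> z \<in> p}"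
    by auto
  have iff: "\<phi> z \<in> p \<longleftrightarrow> \<phi> u \<in> p"
    if "c \<notin> p" "\<forall>\<phi>\<in>E. \<phi> (sc c z) - \<phi> u \<in> p" for c z u
    using that y(2) prime_ideal_cong[OF p, of "\<phi> (sc c z)" "\<phi> u"]
    by (auto simp: E_scale prime_ideal_mult_iff[OF p])
  have "dominated p {z\<in>S. \<phi> z \<in> p} {z\<in>T. \<phi> z \<in> p}"
  proof (rule dominatedI)
    fix z assume z: "z \<in> {z\<in>S. \<phi> z \<in> p}"
    then obtain c u where "c \<notin> p" "u \<in> T" "\<forall>\<phi>\<in>E. \<phi> (sc c z) - \<phi> u \<in> p"
      using Suc.prems(1) unfolding dominated_def by blast
    then show "\<exists>c t. c \<notin> p \<and> t \<in> {z\<in>T. \<phi> z \<in> p} \<and> (\<forall>\<phi>\<in>E. \<phi> (sc c z) - \<phi> t \<in> p)"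
      using iff z by blast
  qed
  then have "rank_ge E p t {z\<in>T. \<phi> z \<in> p}" using Suc.IH y(4) by blast
  moreover obtain c u where "c \<notin> p" "u \<in> T" "\<forall>\<phi>\<in>E. \<phi> (sc c y) - \<phi> u \<in> p"
    using Suc.prems(1) y(1) unfolding dominated_def by blast
  ultimately show ?case using iff y by auto
qed simp

definition adjoin :: "'m set \<Rightarrow> 'm \<Rightarrow> 'm set" where
  "adjoin S x = {s + sc r x | s r. s \<in> S}"

text \<open>If the first functional vanishes on \<open>S\<close> modulo \<open>p\<close>, its kernel
  in \<open>S + Rx\<close> is dominated by \<open>S\<close>. Otherwise it is dominated by the kernel
  in \<open>S\<close> with one element adjoined, and induction applies.\<close>

lemma rank_ge_adjoin:
  assumes p: "prime_ideal p" and "subspace S" "rank_ge E p (Suc t) (adjoin S x)"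
  shows "rank_ge E p t S"
  using assms(2,3)
proof (induction t arbitrary: S x)
  case (Suc t)
  let ?T = "\<lambda>\<phi>. {z\<in>adjoin S x. \<phi> z \<in> p}"
  obtain y \<phi> where y: "y \<in> adjoin S x" "\<phi> \<in> E" "\<phi> y \<notin> p" "rank_ge E p (Suc t) (?T \<phi>)"
    using Suc.prems(2) by (subst (asm) rank_ge.simps) blast
  show ?case
  proof (cases "\<forall>s\<in>S. \<phi> s \<in> p")
    case True
    then have x: "\<phi> x \<notin> p"
      using y p unfolding adjoin_def by (auto simp: E_add E_scale prime_ideal_add prime_ideal_mult)
    have "dominated p (?T \<phi>) S"
    proof (rule dominatedI)
      fix z assume "z \<in> ?T \<phi>"
      then obtain s r where z: "s \<in> S" "z = s + sc r x" "\<phi> s + r * \<phi> x \<in> p"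
        using y(2) by (auto simp: adjoin_def E_add E_scale)
      have "r * \<phi> x \<in> p" using prime_ideal_diff[OF p z(3)] True z(1) by fastforce
      then have "r \<in> p" using x prime_ideal_mult_iff[OF p] by blast
      then have "\<forall>\<phi>\<in>E. \<phi> (sc 1 z) - \<phi> s \<in> p"
        using z p by (auto simp: E_add E_scale prime_ideal_mult)
      then show "\<exists>c t. c \<notin> p \<and> t \<in> S \<and> (\<forall>\<phi>\<in>E. \<phi> (sc c z) - \<phi> t \<in> p)"
        using z(1) prime_ideal_one[OF p] by blast
    qed
    then show ?thesis using rank_ge_dominated[OF p] y(4) by blast
  next
    case False
    then obtain s where s: "s \<in> S" "\<phi> s \<notin> p" by blast
    let ?S = "{z\<in>S. \<phi> z \<in> p}"
    \<comment> \<open>This is \<open>x\<close> corrected by a multiple of \<open>s\<close> so that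
      \<open>\<phi>\<close> is zero on it, with the denominator \<open>\<phi> s\<close>
      cleared.\<close>
    let ?x = "sc (\<phi> s) x - sc (\<phi> x) s"
    have sub: "subspace ?S"
      using Suc.prems(1) y(2) p unfolding subspace_def
      by (auto simp: E_zero E_add E_scale prime_ideal_zero prime_ideal_add prime_ideal_mult)
    have "dominated p (?T \<phi>) (adjoin ?S ?x)"
    proof (rule dominatedI)
      fix z assume "z \<in> ?T \<phi>"
      then obtain v r where z: "v \<in> S" "z = v + sc r x" "\<phi> v + r * \<phi> x \<in> p"
        using y(2) by (auto simp: adjoin_def E_add E_scale)
      let ?v = "sc (\<phi> s) v + sc (r * \<phi> x) s"
      have "sc (\<phi> s) z = ?v + sc r ?x"
        by (simp add: z(2) scale_right_distrib scale_right_diff_distrib mult.commute)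
      moreover have "?v \<in> S" using Suc.prems(1) z(1) s(1) by (intro subspace_add subspace_scale)
      moreover have "\<phi> ?v = \<phi> s * (\<phi> v + r * \<phi> x)"
        using y(2) by (simp add: E_add E_scale algebra_simps)
      then have "\<phi> ?v \<in> p" using z(3) prime_ideal_mult[OF p] by simp
      ultimately have "sc (\<phi> s) z \<in> adjoin ?S ?x" unfolding adjoin_def by blast
      then show "\<exists>c t. c \<notin> p \<and> t \<in> adjoin ?S ?x \<and> (\<forall>\<phi>\<in>E. \<phi> (sc c z) - \<phi> t \<in> p)"
        using s(2) prime_ideal_zero[OF p]
        by (intro exI[of _ "\<phi> s"] exI[of _ "sc (\<phi> s) z"]) simp
    qed
    then have "rank_ge E p (Suc t) (adjoin ?S ?x)" using rank_ge_dominated[OF p] y(4) by blast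
    then have "rank_ge E p t ?S" by (rule Suc.IH[OF sub])
    then show ?thesis using s y(2) by auto
  qed
qed simp

section \<open>Linear combinations and relations modulo a prime\<close>

definition lincombs :: "('i \<Rightarrow> 'm) \<Rightarrow> 'i set \<Rightarrow> 'm set" where
  "lincombs x I = range (\<lambda>c. \<Sum>i\<in>I. sc (c i) (x i))"

lemma subspace_lincombs: "subspace (lincombs x I)"
  unfolding subspace_def
proof (intro conjI ballI allI)
  show "0 \<in> lincombs x I" unfolding lincombs_def by (rule range_eqI[of _ _ "\<lambda>_. 0"]) simp
next
  fix u v assume "u \<in> lincombs x I" "v \<in> lincombs x I"
  then obtain c d where "u = (\<Sum>i\<in>I. sc (c i) (x i))" "v = (\<Sum>i\<in>I. sc (d i) (x i))"
    unfolding lincombs_def by blast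
  then show "u + v \<in> lincombs x I" unfolding lincombs_def
    by (intro range_eqI[of _ _ "\<lambda>i. c i + d i"]) (simp add: scale_left_distrib sum.distrib)
next
  fix r u assume "u \<in> lincombs x I"
  then obtain c where "u = (\<Sum>i\<in>I. sc (c i) (x i))" unfolding lincombs_def by blast
  then show "sc r u \<in> lincombs x I" unfolding lincombs_def
    by (intro range_eqI[of _ _ "\<lambda>i. r * c i"]) (simp add: scale_sum_right)
qed

lemma lincombs_base: "finite I \<Longrightarrow> i \<in> I \<Longrightarrow> x i \<in> lincombs x I"
  unfolding lincombs_def
  by (rule range_eqI[of _ _ "\<lambda>j. if j = i then 1 else 0"]) (simp add: if_distrib[of "\<lambda>c. sc c _"] cong: if_cong)

lemma lincombs_subset: "subspace S \<Longrightarrow> (\<And>i. i \<in> I \<Longrightarrow> x i \<in> S) \<Longrightarrow> lincombs x I \<subseteq> S"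
  unfolding lincombs_def by (auto intro!: subspace_sum subspace_scale)

text \<open>Gaussian elimination over the residue field. The pivot \<open>\<phi> (x j)\<close>
  clears the other members into the kernel of \<open>\<phi>\<close>; full rank of these gives one
  dimension more, and a relation among them lifts to the original family.\<close>

lemma rank_ge_card_or_relation:
  assumes p: "prime_ideal p" and "finite I"
  shows "rank_ge E p (card I) (lincombs x I) \<or>
    (\<exists>c. (\<exists>i\<in>I. c i \<notin> p) \<and> (\<forall>\<phi>\<in>E. \<phi> (\<Sum>i\<in>I. sc (c i) (x i)) \<in> p))"
  using assms(2)
proof (induction "card I" arbitrary: I x)
  case (Suc n)
  show ?case
  proof (cases "\<forall>\<phi>\<in>E. \<forall>i\<in>I. \<phi> (x i) \<in> p")
    case True
    have "\<forall>\<phi>\<in>E. \<phi> (\<Sum>i\<in>I. sc 1 (x i)) \<in> p"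
      using True by (auto simp: E_sum intro!: prime_ideal_sum[OF p])
    moreover have "\<exists>i. i \<in> I" using Suc.hyps(2) by (cases "I = {}") auto
    ultimately show ?thesis using prime_ideal_one[OF p]
      by (intro disjI2 exI[of _ "\<lambda>_. 1"]) auto
  next
    case False
    then obtain \<phi> j where \<phi>: "\<phi> \<in> E" "j \<in> I" "\<phi> (x j) \<notin> p" by blast
    let ?J = "I - {j}"
    let ?x = "\<lambda>i. sc (\<phi> (x j)) (x i) - sc (\<phi> (x i)) (x j)"
    have J: "n = card ?J" "finite ?J" using Suc.hyps(2) Suc.prems \<phi>(2) by auto
    have base: "x i \<in> lincombs x I" if "i \<in> I" for i
      by (rule lincombs_base[OF Suc.prems that])
    from Suc.hyps(1)[OF J, of ?x] show ?thesis
    proof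
      assume rk: "rank_ge E p (card ?J) (lincombs ?x ?J)"
      have ker: "subspace {z \<in> lincombs x I. \<phi> z \<in> p}"
        using subspace_lincombs[of x I] \<phi>(1) p unfolding subspace_def
        by (auto simp: E_zero E_add E_scale prime_ideal_zero prime_ideal_add prime_ideal_mult)
      have "?x i \<in> {z \<in> lincombs x I. \<phi> z \<in> p}" if "i \<in> ?J" for i
        using that \<phi>(1,2) base subspace_lincombs prime_ideal_zero[OF p]
        by (auto simp: E_diff E_scale mult.commute intro!: subspace_diff subspace_scale)
      then have "rank_ge E p (card ?J) {z \<in> lincombs x I. \<phi> z \<in> p}"
        by (intro rank_ge_mono[OF rk] lincombs_subset[OF ker])
      then have "rank_ge E p (Suc (card ?J)) (lincombs x I)" using \<phi> base by auto
      moreover have "Suc (card ?J) = card I" using J(1) Suc.hyps(2) by simp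
      ultimately show ?thesis by (simp only:) simp
    next
      assume "\<exists>c. (\<exists>i\<in>?J. c i \<notin> p) \<and> (\<forall>\<phi>\<in>E. \<phi> (\<Sum>i\<in>?J. sc (c i) (?x i)) \<in> p)"
      then obtain c i where c: "i \<in> ?J" "c i \<notin> p"
        "\<And>\<phi>. \<phi> \<in> E \<Longrightarrow> \<phi> (\<Sum>i\<in>?J. sc (c i) (?x i)) \<in> p" by blast
      \<comment> \<open>The coefficient at \<open>j\<close> collects the multiples of
        \<open>x j\<close> subtracted in clearing. The others only gain the pivot as a factor, so
        one of them stays outside \<open>p\<close>.\<close>
      define d where "d = (\<lambda>i. if i = j then - (\<Sum>i\<in>?J. c i * \<phi> (x i)) else c i * \<phi> (x j))"
      have "(\<Sum>i\<in>I. sc (d i) (x i)) = sc (d j) (x j) + (\<Sum>i\<in>?J. sc (d i) (x i))"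
        using \<phi>(2) Suc.prems by (rule sum.remove[rotated])
      also have "(\<Sum>i\<in>?J. sc (d i) (x i)) = (\<Sum>i\<in>?J. sc (c i * \<phi> (x j)) (x i))"
        by (rule sum.cong) (auto simp: d_def)
      also have "sc (d j) (x j) = - (\<Sum>i\<in>?J. sc (c i * \<phi> (x i)) (x j))"
        by (simp add: d_def scale_sum_left)
      finally have "(\<Sum>i\<in>I. sc (d i) (x i)) = (\<Sum>i\<in>?J. sc (c i) (?x i))"
        by (simp add: scale_right_diff_distrib sum_subtractf)
      moreover have "d i \<notin> p" using c \<phi>(3) prime_ideal_mult_iff[OF p] by (auto simp: d_def)
      ultimately show ?thesis using c by (intro disjI2 exI[of _ d]) auto
    qed
  qed
qed simp

subsection \<open>Eliminating a generator\<close>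

definition shear :: "(nat \<Rightarrow> 'r) \<Rightarrow> (nat \<Rightarrow> 'm) \<Rightarrow> nat \<Rightarrow> (nat \<Rightarrow> 'r) \<Rightarrow> nat \<Rightarrow> 'm" where
  "shear w x k b i = x i + sc (w i * b i) (x k)"

lemma sum_shear:
  "(\<Sum>i<k. sc (c i) (shear w x k b i)) = (\<Sum>i<k. sc (c i) (x i)) + sc (\<Sum>i<k. c i * (w i * b i)) (x k)"
  by (simp add: shear_def scale_right_distrib sum.distrib scale_sum_left)

text \<open>Together with \<open>x k\<close> the shear is invertible: the added multiples of
  \<open>x k\<close> are taken back in the coefficient \<open>r\<close>.\<close>

lemma lincombs_shear:
  assumes "z \<in> lincombs x {..k}"
  shows "\<exists>c r. z = (\<Sum>i<k. sc (c i) (shear w x k b i)) + sc r (x k)"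
proof -
  obtain c where z: "z = (\<Sum>i\<le>k. sc (c i) (x i))" using assms unfolding lincombs_def by blast
  have "z = (\<Sum>i<k. sc (c i) (x i)) + sc (c k) (x k)"
    by (simp add: z lessThan_Suc_atMost[symmetric])
  also have "\<dots> = (\<Sum>i<k. sc (c i) (shear w x k b i)) + sc (c k - (\<Sum>i<k. c i * (w i * b i))) (x k)"
    by (simp add: sum_shear scale_left_diff_distrib)
  finally show ?thesis by blast
qed

text \<open>Adjoining \<open>x k\<close> to the sheared family recovers all former combinations, so
  \<open>rank_ge_adjoin\<close> bounds the loss by one.\<close>

lemma rank_ge_shear:
  assumes p: "prime_ideal p" and "rank_ge E p (Suc t) (lincombs x {..k})"
  shows "rank_ge E p t (lincombs (shear w x k b) {..<k})"
proof (rule rank_ge_adjoin[OF p subspace_lincombs])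
  have "lincombs x {..k} \<subseteq> adjoin (lincombs (shear w x k b) {..<k}) (x k)"
    using lincombs_shear[of _ x k w b] unfolding adjoin_def lincombs_def by blast
  then show "rank_ge E p (Suc t) (adjoin (lincombs (shear w x k b) {..<k}) (x k))"
    by (rule rank_ge_mono[OF assms(2)])
qed

text \<open>Each combination changes by a multiple of \<open>x k\<close> with coefficient in
  \<open>p\<close>. This is the invariance that \<open>simultaneous_choice\<close> needs when
  \<open>b\<close> is corrected at another prime.\<close>

lemma dominated_shear_cong:
  assumes p: "prime_ideal p" and "\<And>i. b' i - b i \<in> p"
  shows "dominated p (lincombs (shear w x k b) {..<k}) (lincombs (shear w x k b') {..<k})"
proof (rule dominatedI)
  fix z assume "z \<in> lincombs (shear w x k b) {..<k}"
  then obtain c where z: "z = (\<Sum>i<k. sc (c i) (shear w x k b i))" unfolding lincombs_def by blast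
  let ?t = "\<Sum>i<k. sc (c i) (shear w x k b' i)"
  have "z - ?t = (\<Sum>i<k. sc (c i) (shear w x k b i - shear w x k b' i))"
    by (simp add: z sum_subtractf scale_right_diff_distrib)
  also have "\<dots> = (\<Sum>i<k. sc ((b' i - b i) * (- c i * w i)) (x k))"
    by (rule sum.cong) (simp_all add: shear_def algebra_simps)
  finally have eq: "z - ?t = sc (\<Sum>i<k. (b' i - b i) * (- c i * w i)) (x k)"
    by (simp add: scale_sum_left)
  have "(\<Sum>i<k. (b' i - b i) * (- c i * w i)) \<in> p"
    by (intro prime_ideal_sum[OF p] prime_ideal_mult[OF p]) (use assms in blast)
  then have "\<forall>\<phi>\<in>E. \<phi> (sc 1 z) - \<phi> ?t \<in> p"
    by (simp add: E_diff[symmetric] eq E_scale prime_ideal_mult[OF p])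
  then show "\<exists>c t. c \<notin> p \<and> t \<in> lincombs (shear w x k b') {..<k} \<and> (\<forall>\<phi>\<in>E. \<phi> (sc c z) - \<phi> t \<in> p)"
    using prime_ideal_one[OF p] unfolding lincombs_def by blast
qed

text \<open>If the sheared family still satisfies a relation modulo \<open>p\<close> with coefficient \<open>c j\<close>,
  one more shear of its \<open>j\<close>-th member turns this relation into a witness that \<open>x k\<close> is
  redundant modulo \<open>p\<close>.\<close>

lemma dominated_shear_update:
  assumes p: "prime_ideal p" and "j < k" "c j * w j \<notin> p" "r \<notin> p"
    and rel: "\<forall>\<phi>\<in>E. \<phi> (\<Sum>i<k. sc (c i) (shear w x k b i)) \<in> p"
  shows "dominated p (lincombs x {..k}) (lincombs (shear w x k (b(j := b j + r))) {..<k})"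
proof (rule dominatedI)
  \<comment> \<open>Under the update the combination with coefficients \<open>c\<close> gains
    \<open>sc ?u (x k)\<close>. As it was zero modulo \<open>p\<close> before, it now stands for
    that multiple of \<open>x k\<close>, which is how \<open>?t\<close> below represents
    \<open>sc ?u z\<close>.\<close>
  let ?b = "b(j := b j + r)" and ?u = "c j * w j * r"
  fix z assume "z \<in> lincombs x {..k}"
  then obtain d \<rho> where z: "z = (\<Sum>i<k. sc (d i) (shear w x k ?b i)) + sc \<rho> (x k)"
    using lincombs_shear by blast
  let ?t = "\<Sum>i<k. sc (?u * d i + \<rho> * c i) (shear w x k ?b i)"
  let ?rel = "\<Sum>i<k. sc (c i) (shear w x k b i)"
  have "(\<Sum>i<k. c i * (w i * ?b i)) = (\<Sum>i<k. c i * (w i * b i) + (if i = j then ?u else 0))"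
    by (rule sum.cong) (auto simp: algebra_simps)
  also have "\<dots> = (\<Sum>i<k. c i * (w i * b i)) + ?u" using \<open>j < k\<close> by (simp add: sum.distrib)
  finally have "(\<Sum>i<k. sc (c i) (shear w x k ?b i)) = ?rel + sc ?u (x k)"
    unfolding sum_shear by (simp only: scale_left_distrib add.assoc)
  moreover have "?t = sc ?u (\<Sum>i<k. sc (d i) (shear w x k ?b i)) + sc \<rho> (\<Sum>i<k. sc (c i) (shear w x k ?b i))"
    by (simp only: scale_left_distrib sum.distrib scale_sum_right scale_scale)
  ultimately have "sc ?u z - ?t = - sc \<rho> ?rel"
    by (simp only: z scale_right_distrib scale_scale mult.commute[of ?u \<rho>]) simp
  also have "\<dots> = sc (- \<rho>) ?rel" by simp
  finally have eq: "sc ?u z - ?t = sc (- \<rho>) ?rel" .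
  have "\<phi> (sc ?u z) - \<phi> ?t \<in> p" if "\<phi> \<in> E" for \<phi>
  proof -
    have "\<phi> (sc ?u z) - \<phi> ?t = \<phi> (sc ?u z - ?t)" by (rule E_diff[OF that, symmetric])
    also have "\<dots> = - \<rho> * \<phi> ?rel" by (simp only: eq E_scale[OF that])
    finally show ?thesis using prime_ideal_mult[OF p, of "- \<rho>"] rel that by simp
  qed
  moreover have "?u \<notin> p" using assms prime_ideal_mult_iff[OF p] by blast
  moreover have "?t \<in> lincombs (shear w x k ?b) {..<k}"
    unfolding lincombs_def by (rule range_eqI[of _ _ "\<lambda>i. ?u * d i + \<rho> * c i"]) (rule refl)
  ultimately show "\<exists>c t. c \<notin> p \<and> t \<in> lincombs (shear w x k ?b) {..<k} \<and> (\<forall>\<phi>\<in>E. \<phi> (sc c z) - \<phi> t \<in> p)"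
    by blast
qed

text \<open>The factor \<open>a\<close> at index 0 keeps the first member in the form
  \<open>y + az\<close>; the others may move freely.\<close>

definition weight :: "'r \<Rightarrow> nat \<Rightarrow> 'r" where
  "weight a i = (if i = 0 then a else 1)"

text \<open>If the sheared family has rank \<open>k\<close>, nothing is lost, since the old rank is
  at most \<open>k\<close>. Otherwise it satisfies a relation modulo \<open>p\<close>, and
  \<open>dominated_shear_update\<close> applies.\<close>

lemma shear_rank_preserving:
  assumes p: "prime_ideal p" and r: "r \<notin> p"
    and a: "a \<notin> p \<or> (\<exists>\<phi>\<in>E. \<phi> (x 0) \<notin> p)"
    and nrank: "\<not> rank_ge E p (Suc k) (lincombs x {..k})"
  defines "G \<equiv> \<lambda>b. \<forall>t. rank_ge E p t (lincombs x {..k}) \<longrightarrow>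
      rank_ge E p t (lincombs (shear (weight a) x k b) {..<k})"
  shows "G b \<or> (\<exists>j. G (b(j := b j + r)))"
proof -
  let ?x = "shear (weight a) x k b"
  from rank_ge_card_or_relation[OF p finite_lessThan, of k ?x] show ?thesis
  proof
    assume full: "rank_ge E p (card {..<k}) (lincombs ?x {..<k})"
    have "G b" unfolding G_def
    proof (intro allI impI)
      fix t assume "rank_ge E p t (lincombs x {..k})"
      then have "t \<le> k" using nrank rank_ge_antimono not_less_eq_eq by blast
      then show "rank_ge E p t (lincombs ?x {..<k})" using full rank_ge_antimono by simp
    qed
    then show ?thesis ..
  next
    assume "\<exists>c. (\<exists>i\<in>{..<k}. c i \<notin> p) \<and> (\<forall>\<phi>\<in>E. \<phi> (\<Sum>i<k. sc (c i) (?x i)) \<in> p)"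
    then obtain c i where c: "i < k" "c i \<notin> p" and
      rel: "\<forall>\<phi>\<in>E. \<phi> (\<Sum>i<k. sc (c i) (?x i)) \<in> p" by blast
    \<comment> \<open>Failure would put \<open>a\<close> and every coefficient except
      \<open>c 0\<close> into \<open>p\<close>. The relation would then make all functionals vanish
      on \<open>x 0\<close> modulo \<open>p\<close>, against \<open>a\<close>.\<close>
    have "\<exists>j<k. c j * weight a j \<notin> p"
    proof (rule ccontr)
      assume "\<not> ?thesis"
      then have cw: "c j * weight a j \<in> p" if "j < k" for j using that by blast
      then have cj: "c j \<in> p" if "j < k" "j \<noteq> 0" for j using that cw[of j] by (simp add: weight_def)
      then have "i = 0" using c by blast
      then have "a \<in> p" using c cw[of 0] by (simp add: weight_def prime_ideal_mult_iff[OF p])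
      then obtain \<phi> where \<phi>: "\<phi> \<in> E" "\<phi> (x 0) \<notin> p" using a by blast
      have "(\<Sum>i<k. c i * \<phi> (?x i)) \<in> p" using rel \<phi>(1) by (simp add: E_sum E_scale)
      moreover have "(\<Sum>i<k. c i * \<phi> (?x i)) = c 0 * \<phi> (?x 0) + (\<Sum>i\<in>{..<k} - {0}. c i * \<phi> (?x i))"
        using c(1) by (intro sum.remove) auto
      moreover have "(\<Sum>i\<in>{..<k} - {0}. c i * \<phi> (?x i)) \<in> p"
        using cj by (intro prime_ideal_sum[OF p] prime_ideal_mult[OF p]) simp
      ultimately have "c 0 * \<phi> (?x 0) \<in> p" using prime_ideal_diff[OF p] by fastforce
      then have "\<phi> (?x 0) \<in> p" using c(2) \<open>i = 0\<close> prime_ideal_mult_iff[OF p] by blast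
      moreover have "\<phi> (?x 0) - \<phi> (x 0) \<in> p" using \<phi>(1) \<open>a \<in> p\<close>
        by (simp add: shear_def weight_def E_add E_scale prime_ideal_mult[OF p])
      ultimately show False using \<phi>(2) prime_ideal_cong[OF p] by blast
    qed
    then obtain j where "j < k" "c j * weight a j \<notin> p" by blast
    from rank_ge_dominated[OF p dominated_shear_update[OF p this r rel]]
    have "G (b(j := b j + r))" unfolding G_def by simp
    then show ?thesis by blast
  qed
qed

text \<open>A drop by one is harmless where the rank is at least \<open>k + 1\<close>, and at a
  prime of rank \<open>t\<close> strictly above a member of \<open>F t\<close>. The remaining primes
  lie in the finite set \<open>B\<close>, where \<open>b\<close> preserves the rank.\<close>

lemma shear_reduction:
  fixes d :: "'r set \<Rightarrow> nat"
  assumes noeth: "noetherian_ring TYPE('r)"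
    and X: "\<And>p. p \<in> X \<Longrightarrow> prime_ideal p"
    and closed: "\<And>Z. Z \<subseteq> X \<Longrightarrow> prime_ideal (\<Inter>Z) \<Longrightarrow> \<Inter>Z \<in> X"
    and d: "\<And>p q. p \<in> X \<Longrightarrow> q \<in> X \<Longrightarrow> q \<subset> p \<Longrightarrow> d p < d q"
    and a: "\<And>p. p \<in> X \<Longrightarrow> a \<notin> p \<or> (\<exists>\<phi>\<in>E. \<phi> (x 0) \<notin> p)"
    and rank: "\<And>p. p \<in> X \<Longrightarrow> rank_ge E p (min (Suc k) (d p)) (lincombs x {..k})"
  shows "\<exists>b. \<forall>p\<in>X. rank_ge E p (min k (d p)) (lincombs (shear (weight a) x k b) {..<k})"
proof -
  let ?S = "lincombs x {..k}" and ?T = "\<lambda>b. lincombs (shear (weight a) x k b) {..<k}"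
  let ?Y = "\<lambda>t. {p \<in> X. \<not> rank_ge E p (Suc t) ?S}"
  have "\<forall>t. \<exists>F. finite F \<and> F \<subseteq> ?Y t \<and> (\<forall>p\<in>?Y t. \<exists>q\<in>F. q \<subseteq> p)"
  proof (rule allI, rule finite_lower_primes[OF noeth])
    fix t Z assume Z: "Z \<subseteq> ?Y t" "prime_ideal (\<Inter>Z)"
    then have "\<Inter>Z \<in> X" using closed by blast
    moreover have "\<not> rank_ge E (\<Inter>Z) (Suc t) ?S"
    proof
      assume "rank_ge E (\<Inter>Z) (Suc t) ?S"
      then have "\<exists>p\<in>Z. rank_ge E p (Suc t) ?S"
        by (rule rank_ge_Inter[OF Z(2), rotated]) (use Z(1) X in blast)
      then show False using Z(1) by blast
    qed
    ultimately show "\<Inter>Z \<in> ?Y t" by blast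
  qed (use X in blast)
  from choice[OF this] obtain F
    where "\<forall>t. finite (F t) \<and> F t \<subseteq> ?Y t \<and> (\<forall>p\<in>?Y t. \<exists>q\<in>F t. q \<subseteq> p)" ..
  then have F: "\<And>t. finite (F t)" "\<And>t. F t \<subseteq> ?Y t" "\<And>t p. p \<in> ?Y t \<Longrightarrow> \<exists>q\<in>F t. q \<subseteq> p"
    by simp_all
  \<comment> \<open>Each rank \<open>t\<close> has its own \<open>F t\<close>: a prime of exact rank
    \<open>t\<close> must be compared with one of rank at most \<open>t\<close> below it.\<close>
  define B where "B = (\<Union>t\<le>k. F t)"
  define G where "G = (\<lambda>p b. \<forall>t. rank_ge E p t ?S \<longrightarrow> rank_ge E p t (?T b))"
  have B: "p \<in> X" "\<not> rank_ge E p (Suc k) ?S" if "p \<in> B" for p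
  proof -
    obtain t where t: "t \<le> k" "p \<in> F t" using \<open>p \<in> B\<close> unfolding B_def by blast
    then have "p \<in> ?Y t" using F(2) by blast
    then show "p \<in> X" "\<not> rank_ge E p (Suc k) ?S"
      using rank_ge_antimono[of E p "Suc k" ?S "Suc t"] t(1) by auto
  qed
  have "\<exists>b. \<forall>p\<in>B. G p b"
  proof (rule simultaneous_choice)
    show "finite B" unfolding B_def using F(1) by blast
    show "prime_ideal p" if "p \<in> B" for p using B that X by blast
    show "G p b'" if "p \<in> B" "G p b" "\<And>i. b' i - b i \<in> p" for p b b'
      using that(2) rank_ge_dominated[OF _ dominated_shear_cong[of p b' b]] X[OF B(1)[OF that(1)]] that(3)
      unfolding G_def by simp
    show "G p b \<or> (\<exists>j. G p (b(j := b j + r)))" if "p \<in> B" "r \<notin> p" for p b r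
      unfolding G_def using that B[OF that(1)] X a by (intro shear_rank_preserving) auto
  qed
  then obtain b where b: "\<And>p. p \<in> B \<Longrightarrow> G p b" by blast
  have "rank_ge E p (min k (d p)) (?T b)" if p: "p \<in> X" for p
  proof (cases "rank_ge E p (Suc k) ?S")
    case True
    then have "rank_ge E p k (?T b)" using rank_ge_shear X[OF p] by blast
    then show ?thesis by (rule rank_ge_antimono) simp
  next
    case False
    obtain t where t: "t < Suc k" "rank_ge E p t ?S" "\<not> rank_ge E p (Suc t) ?S"
      using False ex_least_nat_less[of "\<lambda>t. \<not> rank_ge E p t ?S" "Suc k"] by fastforce
    then have "p \<in> ?Y t" using p by blast
    then obtain q where q: "q \<in> F t" "q \<subseteq> p" using F(3) by blast
    \<comment> \<open>At \<open>v\<close> the rank is at most \<open>t\<close>, so the invariant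
      bounds the minimum. As \<open>t\<close> is at most \<open>k\<close>, this means
      \<open>d v \<le> t\<close>.\<close>
    have le: "min (Suc k) (d v) \<le> t" if "v \<in> F t" for v
    proof (rule ccontr)
      have v: "v \<in> X" "\<not> rank_ge E v (Suc t) ?S" using F(2)[of t] that by auto
      assume "\<not> min (Suc k) (d v) \<le> t"
      then have "Suc t \<le> min (Suc k) (d v)" by linarith
      then show False using rank_ge_antimono[OF rank[OF v(1)]] v(2) by blast
    qed
    show ?thesis
    proof (cases "q = p")
      case True
      then have "G p b" using q(1) t(1) b unfolding B_def by force
      then have "rank_ge E p t (?T b)" using t(2) unfolding G_def by blast
      moreover have "min k (d p) \<le> t" using le[OF q(1)] unfolding True by linarith
      ultimately show ?thesis by (rule rank_ge_antimono)
    next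
      case False
      have "q \<in> X" using q(1) F(2) by blast
      then have "d p < d q" using d p q(2) False by blast
      then have "min k (d p) < t" using le[OF q(1)] t(1) by linarith
      then obtain t' where t': "t = Suc t'" "min k (d p) \<le> t'" by (cases t) auto
      then have "rank_ge E p t' (?T b)" using rank_ge_shear[OF X[OF p]] t(2) by blast
      then show ?thesis using t'(2) rank_ge_antimono by blast
    qed
  qed
  then show ?thesis by blast
qed

text \<open>Each shear removes the last generator and moves \<open>x 0\<close> by \<open>a\<close>
  times an element of \<open>N\<close>; these elements add up to \<open>z\<close>. Once
  \<open>x 0\<close> is alone, positivity of \<open>d\<close> makes its rank one at every prime of
  \<open>X\<close>.\<close>

lemma exists_nonvanishing:
  fixes d :: "'r set \<Rightarrow> nat"
  assumes noeth: "noetherian_ring TYPE('r)"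
    and X: "\<And>p. p \<in> X \<Longrightarrow> prime_ideal p"
    and closed: "\<And>Z. Z \<subseteq> X \<Longrightarrow> prime_ideal (\<Inter>Z) \<Longrightarrow> \<Inter>Z \<in> X"
    and d: "\<And>p q. p \<in> X \<Longrightarrow> q \<in> X \<Longrightarrow> q \<subset> p \<Longrightarrow> d p < d q"
    and pos: "\<And>p. p \<in> X \<Longrightarrow> 0 < d p"
    and N: "subspace N" "\<And>i. i \<le> k \<Longrightarrow> x i \<in> N"
    and a: "\<And>p. p \<in> X \<Longrightarrow> a \<notin> p \<or> (\<exists>\<phi>\<in>E. \<phi> (x 0) \<notin> p)"
    and rank: "\<And>p. p \<in> X \<Longrightarrow> rank_ge E p (min (Suc k) (d p)) (lincombs x {..k})"
  shows "\<exists>z\<in>N. \<forall>p\<in>X. \<exists>\<phi>\<in>E. \<phi> (x 0 + sc a z) \<notin> p"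
  using N(2) a rank
proof (induction k arbitrary: x)
  case 0
  have "\<exists>\<phi>\<in>E. \<phi> (x 0) \<notin> p" if p: "p \<in> X" for p
  proof -
    have "min (Suc 0) (d p) = Suc 0" using pos[OF p] by simp
    then have "rank_ge E p (Suc 0) (lincombs x {..0})" using "0.prems"(3)[OF p] by (simp only:)
    then obtain y \<phi> where "y \<in> lincombs x {..0}" "\<phi> \<in> E" "\<phi> y \<notin> p" by auto
    then obtain c where "\<phi> (sc c (x 0)) \<notin> p" unfolding lincombs_def by auto
    then show ?thesis using \<open>\<phi> \<in> E\<close> prime_ideal_mult[OF X[OF p]] by (auto simp: E_scale)
  qed
  then show ?case using subspace_0[OF N(1)] by (intro bexI[of _ 0]) simp_all
next
  case (Suc k)
  obtain b where b: "\<And>p. p \<in> X \<Longrightarrow>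
      rank_ge E p (min (Suc k) (d p)) (lincombs (shear (weight a) x (Suc k) b) {..<Suc k})"
    using shear_reduction[OF noeth X closed d Suc.prems(2,3)] by blast
  let ?x = "shear (weight a) x (Suc k) b"
  have x0: "?x 0 = x 0 + sc a (sc (b 0) (x (Suc k)))" by (simp add: shear_def weight_def)
  have "\<exists>z\<in>N. \<forall>p\<in>X. \<exists>\<phi>\<in>E. \<phi> (?x 0 + sc a z) \<notin> p"
  proof (rule Suc.IH)
    show "?x i \<in> N" if "i \<le> k" for i
      unfolding shear_def using that Suc.prems(1) by (intro subspace_add[OF N(1)] subspace_scale[OF N(1)]) auto
    \<comment> \<open>Where \<open>a\<close> lies in \<open>p\<close>, the shear leaves
      \<open>x 0\<close> unchanged modulo \<open>p\<close>.\<close>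
    show "a \<notin> p \<or> (\<exists>\<phi>\<in>E. \<phi> (?x 0) \<notin> p)" if p: "p \<in> X" for p
    proof (cases "a \<in> p")
      case True
      then obtain \<phi> where \<phi>: "\<phi> \<in> E" "\<phi> (x 0) \<notin> p" using Suc.prems(2)[OF p] by blast
      then have "\<phi> (?x 0) - \<phi> (x 0) \<in> p"
        using True by (simp add: x0 E_add E_scale prime_ideal_mult[OF X[OF p]])
      then show ?thesis using \<phi> prime_ideal_cong[OF X[OF p]] by blast
    qed simp
    show "rank_ge E p (min (Suc k) (d p)) (lincombs ?x {..k})" if "p \<in> X" for p
      using b[OF that] by (simp only: lessThan_Suc_atMost)
  qed
  then obtain z where z: "z \<in> N" "\<forall>p\<in>X. \<exists>\<phi>\<in>E. \<phi> (?x 0 + sc a z) \<notin> p" by blast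
  have "?x 0 + sc a z = x 0 + sc a (sc (b 0) (x (Suc k)) + z)"
    unfolding x0 by (simp only: scale_right_distrib add.assoc)
  moreover have "sc (b 0) (x (Suc k)) + z \<in> N"
    using Suc.prems(1) z(1) by (intro subspace_add[OF N(1)] subspace_scale[OF N(1)]) auto
  ultimately show ?case using z(2) by auto
qed

end

subsection \<open>Localization at a prime\<close>

locale localization = module sc
  for sc :: "'r::comm_ring_1 \<Rightarrow> 'm::ab_group_add \<Rightarrow> 'm" +
  fixes p :: "'r set"
  assumes prime: "prime_ideal p"
begin

lemma notin_mult: "s \<notin> p \<Longrightarrow> t \<notin> p \<Longrightarrow> s * t \<notin> p"
  using prime_ideal_mult_iff[OF prime] by blast

lemma frac_eqI:
  assumes "s \<notin> p" "s' \<notin> p" "u \<notin> p" "sc u (sc s' m) = sc u (sc s m')"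
  shows "frac sc p m s = frac sc p m' s'"
proof -
  have trans: "((m2, s2), v) \<in> frac_rel sc p"
    if "((m1, s1), v) \<in> frac_rel sc p" "s1 \<notin> p" "s2 \<notin> p" "u \<notin> p"
      "sc u (sc s2 m1) = sc u (sc s1 m2)" for m1 s1 m2 s2 u v
  proof -
    obtain m3 s3 where v3: "v = (m3, s3)" by (cases v)
    with that(1) obtain w where v: "v = (m3, s3)" "s3 \<notin> p" "w \<notin> p" "sc w (sc s3 m1 - sc s1 m3) = 0"
      unfolding frac_rel_def by auto
    \<comment> \<open>The factor \<open>s1\<close> lets \<open>m2\<close> be traded for
      \<open>m1\<close> through \<open>u\<close>; then \<open>w\<close> relates \<open>m1\<close> to
      \<open>m3\<close>.\<close>
    have "sc (w * u * s1) (sc s3 m2 - sc s2 m3) =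
        sc (w * s3) (sc u (sc s1 m2)) - sc (w * u * s1 * s2) m3"
      by (simp add: scale_right_diff_distrib mult_ac)
    also have "\<dots> = sc (w * s3) (sc u (sc s2 m1)) - sc (w * u * s1 * s2) m3"
      by (simp only: that(5))
    also have "\<dots> = sc (u * s2) (sc w (sc s3 m1 - sc s1 m3))"
      by (simp add: scale_right_diff_distrib mult_ac)
    finally have "sc (w * u * s1) (sc s3 m2 - sc s2 m3) = 0" using v(4) by simp
    moreover have "w * u * s1 \<notin> p" using v that by (intro notin_mult)
    ultimately show ?thesis using v that unfolding frac_rel_def by blast
  qed
  show ?thesis
    using trans[of m s _ s' u m'] trans[of m' s' _ s u m] assms
    unfolding frac_def by (intro set_eqI) (auto simp: Image_def)
qed

lemma frac_eqD:
  assumes "s \<notin> p" "s' \<notin> p" "frac sc p m s = frac sc p m' s'"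
  shows "\<exists>u. u \<notin> p \<and> sc u (sc s' m) = sc u (sc s m')"
proof -
  have "(m', s') \<in> frac sc p m' s'"
    using assms(2) prime_ideal_one[OF prime] unfolding frac_def frac_rel_def by auto
  then have "(m', s') \<in> frac sc p m s" using assms(3) by simp
  then show ?thesis unfolding frac_def frac_rel_def by (auto simp: scale_right_diff_distrib)
qed

lemma frac_in_Mloc: "m \<in> S \<Longrightarrow> s \<notin> p \<Longrightarrow> frac sc p m s \<in> Mloc sc p S"
  unfolding Mloc_def by blast

lemma Mloc_cases:
  assumes "v \<in> Mloc sc p S"
  obtains m s where "m \<in> S" "s \<notin> p" "v = frac sc p m s"
  using assms unfolding Mloc_def by blast

text \<open>The definite description ranges over all representatives, so independence of their
  choice is needed; the witnesses \<open>u\<close> and \<open>v\<close> of the two equalities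
  multiply to one for the sum.\<close>

lemma loc_add_frac:
  assumes s: "s \<notin> p" "s' \<notin> p"
  shows "loc_add sc p (frac sc p m s) (frac sc p m' s') = frac sc p (sc s' m + sc s m') (s * s')"
  unfolding loc_add_def
proof (rule the_equality)
  fix c assume "\<exists>m1 s1 m1' s1'. s1 \<notin> p \<and> s1' \<notin> p \<and> frac sc p m s = frac sc p m1 s1 \<and>
    frac sc p m' s' = frac sc p m1' s1' \<and> c = frac sc p (sc s1' m1 + sc s1 m1') (s1 * s1')"
  then obtain m1 s1 m1' s1' where 1: "s1 \<notin> p" "s1' \<notin> p" "frac sc p m s = frac sc p m1 s1"
    "frac sc p m' s' = frac sc p m1' s1'" and c: "c = frac sc p (sc s1' m1 + sc s1 m1') (s1 * s1')"
    by blast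
  obtain u where u: "u \<notin> p" "sc u (sc s1 m) = sc u (sc s m1)" using frac_eqD[OF s(1) 1(1,3)] by blast
  obtain v where v: "v \<notin> p" "sc v (sc s1' m') = sc v (sc s' m1')" using frac_eqD[OF s(2) 1(2,4)] by blast
  have "sc (u * v) (sc (s * s') (sc s1' m1 + sc s1 m1')) =
      sc (v * s1' * s') (sc u (sc s m1)) + sc (u * s * s1) (sc v (sc s' m1'))"
    by (simp add: scale_right_distrib mult_ac)
  also have "\<dots> = sc (v * s1' * s') (sc u (sc s1 m)) + sc (u * s * s1) (sc v (sc s1' m'))"
    by (simp only: u v)
  also have "\<dots> = sc (u * v) (sc (s1 * s1') (sc s' m + sc s m'))"
    by (simp add: scale_right_distrib mult_ac)
  finally show "c = frac sc p (sc s' m + sc s m') (s * s')" unfolding c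
    using s u(1) v(1) 1 by (intro frac_eqI[of _ _ "u * v"] notin_mult)
qed (use s in blast)

lemma loc_smult_frac:
  assumes s: "t \<notin> p" "s \<notin> p"
  shows "loc_smult sc p (frac ((*)) p a t) (frac sc p m s) = frac sc p (sc a m) (t * s)"
  unfolding loc_smult_def
proof (rule the_equality)
  interpret R: localization "(*)" p
    by (simp add: localization_def localization_axioms_def module_mult prime)
  fix c assume "\<exists>c0 u m1 s1. u \<notin> p \<and> s1 \<notin> p \<and> frac (*) p a t = frac (*) p c0 u \<and>
    frac sc p m s = frac sc p m1 s1 \<and> c = frac sc p (sc c0 m1) (u * s1)"
  then obtain a1 t1 m1 s1 where 1: "t1 \<notin> p" "s1 \<notin> p" "frac (*) p a t = frac (*) p a1 t1"
    "frac sc p m s = frac sc p m1 s1" and c: "c = frac sc p (sc a1 m1) (t1 * s1)"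
    by blast
  obtain u where u: "u \<notin> p" "u * (t1 * a) = u * (t * a1)" using R.frac_eqD[OF s(1) 1(1,3)] by blast
  obtain v where v: "v \<notin> p" "sc v (sc s1 m) = sc v (sc s m1)" using frac_eqD[OF s(2) 1(2,4)] by blast
  have "sc (u * v) (sc (t * s) (sc a1 m1)) = sc (u * (t * a1)) (sc v (sc s m1))"
    by (simp add: mult_ac del: R.scale_scale)
  also have "\<dots> = sc (u * (t1 * a)) (sc v (sc s1 m))" by (simp only: u v)
  also have "\<dots> = sc (u * v) (sc (t1 * s1) (sc a m))"
    by (simp add: mult_ac del: R.scale_scale)
  finally show "c = frac sc p (sc a m) (t * s)" unfolding c
    using s u(1) v(1) 1 by (intro frac_eqI[of _ _ "u * v"] notin_mult)
qed (use s in blast)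

lemma loc_add_zero: "v \<in> Mloc sc p UNIV \<Longrightarrow> loc_add sc p v (loc_zero sc p) = v"
  by (erule Mloc_cases) (simp add: loc_zero_def loc_add_frac prime_ideal_one[OF prime])

text \<open>If \<open>v = f + g\<close> with \<open>v\<close> and \<open>f\<close> in
  \<open>F\<close>, then \<open>g = v - f\<close> lies in both \<open>F\<close> and
  \<open>G\<close>, hence is zero.\<close>

lemma summand_proj_self:
  assumes F: "loc_submodule sc p F" and G: "loc_submodule sc p G" "F \<inter> G = {loc_zero sc p}"
    and v: "v \<in> F"
  shows "summand_proj sc p F G v = v"
  unfolding summand_proj_def
proof (rule the_equality)
  have vM: "v \<in> Mloc sc p UNIV" using F v unfolding loc_submodule_def by blast
  show "v \<in> F \<and> (\<exists>g\<in>G. v = loc_add sc p v g)"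
    using v loc_add_zero[OF vM] G(2) by (metis IntD2 insertI1)
  fix f assume "f \<in> F \<and> (\<exists>g\<in>G. v = loc_add sc p f g)"
  then obtain g where f: "f \<in> F" and g: "g \<in> G" "v = loc_add sc p f g" by blast
  have fM: "f \<in> Mloc sc p UNIV" using F f unfolding loc_submodule_def by blast
  have gM: "g \<in> Mloc sc p UNIV" using G g(1) unfolding loc_submodule_def by blast
  obtain m s where m: "s \<notin> p" "f = frac sc p m s" using fM by (rule Mloc_cases)
  obtain n t where n: "t \<notin> p" "g = frac sc p n t" using gM by (rule Mloc_cases)
  \<comment> \<open>Submodules are closed under \<open>loc_add\<close> and \<open>loc_smult\<close>,
    so \<open>f\<close> is subtracted by scaling with the fraction -1/1.\<close>
  let ?e = "frac ((*)) p (-1) 1"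
  have one: "1 \<notin> p" by (rule prime_ideal_one[OF prime])
  have e: "?e \<in> Rloc p" unfolding Mloc_def using one by blast
  have neg: "loc_smult sc p ?e f = frac sc p (- m) s"
    using m one by (simp add: loc_smult_frac)
  have vF: "v = frac sc p (sc t m + sc s n) (s * t)"
    using g(2) m n by (simp add: loc_add_frac)
  have "loc_add sc p (loc_smult sc p ?e f) v =
      frac sc p (sc (s * t) (- m) + sc s (sc t m + sc s n)) (s * (s * t))"
    unfolding neg vF using m n notin_mult by (intro loc_add_frac) auto
  also have "sc (s * t) (- m) + sc s (sc t m + sc s n) = sc (s * s) n"
    by (simp add: scale_right_distrib)
  also have "frac sc p (sc (s * s) n) (s * (s * t)) = g"
    unfolding n(2) using m n one by (intro frac_eqI[of _ _ 1] notin_mult) (simp_all add: mult_ac)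
  finally have "g \<in> F" using F f v e unfolding loc_submodule_def by metis
  then have "g = loc_zero sc p" using g(1) G(2) by blast
  then show "f = v" using g(2) loc_add_zero[OF fM] by simp
qed

end

section \<open>Localized functionals, free-basic elements and free summands\<close>

locale localized_functionals = module_functionals sc E + localization sc p
  for sc :: "'r::comm_ring_1 \<Rightarrow> 'm::ab_group_add \<Rightarrow> 'm" and E :: "('m \<Rightarrow> 'r) set" and p :: "'r set"
begin

sublocale R: localization "(*)" p
  by (simp add: localization_def localization_axioms_def module_mult prime)

text \<open>This instance of \<open>scale_scale\<close> reassociates products and makes \<open>mult_ac\<close> loop.\<close>

declare R.scale_scale [simp del]

lemma loc_map_frac:
  assumes "\<phi> \<in> E" and s: "s \<notin> p" "t \<notin> p"
  shows "loc_map sc p \<phi> s (frac sc p m t) = frac ((*)) p (\<phi> m) (s * t)"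
proof -
  have "(THE c. \<exists>m1 t1. t1 \<notin> p \<and> frac sc p m t = frac sc p m1 t1 \<and> c = frac (*) p (\<phi> m1) (s * t1))
      = frac ((*)) p (\<phi> m) (s * t)"
  proof (rule the_equality)
    fix c assume "\<exists>m1 t1. t1 \<notin> p \<and> frac sc p m t = frac sc p m1 t1 \<and> c = frac (*) p (\<phi> m1) (s * t1)"
    then obtain m1 t1 where 1: "t1 \<notin> p" "frac sc p m t = frac sc p m1 t1"
      and c: "c = frac (*) p (\<phi> m1) (s * t1)" by blast
    obtain u where u: "u \<notin> p" "sc u (sc t1 m) = sc u (sc t m1)" using frac_eqD[OF s(2) 1] by blast
    have "u * (t1 * \<phi> m) = u * (t * \<phi> m1)"
      using arg_cong[OF u(2), of \<phi>] assms(1) by (simp only: E_scale)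
    then have "u * (s * t * \<phi> m1) = u * (s * t1 * \<phi> m)"
      by (metis mult.assoc mult.left_commute)
    then show "c = frac (*) p (\<phi> m) (s * t)" unfolding c
      using s u(1) 1 by (intro R.frac_eqI[of _ _ u] notin_mult)
  qed (use s in blast)
  then show ?thesis unfolding loc_map_def using frac_in_Mloc[of m UNIV t] s by simp
qed

lemma loc_map_linear:
  assumes "\<phi> \<in> E" "S \<subseteq> Mloc sc p UNIV"
  shows "loc_linear sc ((*)) p S (loc_map sc p \<phi> 1)"
  unfolding loc_linear_def
proof (intro conjI ballI)
  note one = prime_ideal_one[OF prime]
  fix a b assume "a \<in> S" "b \<in> S"
  then have "a \<in> Mloc sc p UNIV" "b \<in> Mloc sc p UNIV" using assms(2) by auto
  then obtain m s n t where "s \<notin> p" "a = frac sc p m s" "t \<notin> p" "b = frac sc p n t"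
    by (metis Mloc_cases)
  then show "loc_map sc p \<phi> 1 (loc_add sc p a b)
      = loc_add (*) p (loc_map sc p \<phi> 1 a) (loc_map sc p \<phi> 1 b)"
    using assms(1) one
    by (simp add: loc_add_frac R.loc_add_frac loc_map_frac notin_mult E_add E_scale)
next
  note one = prime_ideal_one[OF prime]
  fix r a assume "r \<in> Rloc p" "a \<in> S"
  then have "r \<in> Rloc p" "a \<in> Mloc sc p UNIV" using assms(2) by auto
  then obtain c u m s where "u \<notin> p" "r = frac (*) p c u" "s \<notin> p" "a = frac sc p m s"
    by (metis Mloc_cases R.Mloc_cases)
  then show "loc_map sc p \<phi> 1 (loc_smult sc p r a) = loc_smult (*) p r (loc_map sc p \<phi> 1 a)"
    using assms(1) one
    by (simp add: loc_smult_frac R.loc_smult_frac loc_map_frac notin_mult E_scale)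
qed

text \<open>As \<open>\<phi> x\<close> becomes a unit, it can be absorbed into the witness of
  equality for injectivity and put into the denominator for surjectivity.\<close>

lemma bij_betw_loc_map:
  assumes \<phi>: "\<phi> \<in> E" "\<phi> x \<notin> p"
  shows "bij_betw (loc_map sc p \<phi> 1) (Mloc sc p (range (\<lambda>r. sc r x))) (Rloc p)"
  unfolding bij_betw_def
proof
  note one = prime_ideal_one[OF prime]
  let ?M = "Mloc sc p (range (\<lambda>r. sc r x))"
  have map: "loc_map sc p \<phi> 1 (frac sc p (sc c x) s) = frac (*) p (c * \<phi> x) s" if "s \<notin> p" for c s
    using loc_map_frac[OF \<phi>(1) one that] \<phi>(1) by (simp add: E_scale)
  show "inj_on (loc_map sc p \<phi> 1) ?M"
  proof (rule inj_onI)
    fix v v' assume v: "v \<in> ?M" "v' \<in> ?M" "loc_map sc p \<phi> 1 v = loc_map sc p \<phi> 1 v'"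
    obtain c s where c: "s \<notin> p" "v = frac sc p (sc c x) s" using v(1) by (auto elim: Mloc_cases)
    obtain c' s' where c': "s' \<notin> p" "v' = frac sc p (sc c' x) s'" using v(2) by (auto elim: Mloc_cases)
    have "frac (*) p (c * \<phi> x) s = frac (*) p (c' * \<phi> x) s'" using v(3) c c' map by simp
    then obtain u where u: "u \<notin> p" "u * (s' * (c * \<phi> x)) = u * (s * (c' * \<phi> x))"
      using R.frac_eqD[OF c(1) c'(1)] by blast
    have "(u * \<phi> x) * (s' * c) = (u * \<phi> x) * (s * c')" using u(2) by (simp add: mult_ac)
    then have "sc (u * \<phi> x) (sc s' (sc c x)) = sc (u * \<phi> x) (sc s (sc c' x))"
      by (simp only: scale_scale)
    then show "v = v'" unfolding c c'
      using c c' u \<phi> by (intro frac_eqI[of _ _ "u * \<phi> x"] notin_mult)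
  qed
  show "loc_map sc p \<phi> 1 ` ?M = Rloc p"
  proof
    show "loc_map sc p \<phi> 1 ` ?M \<subseteq> Rloc p"
    proof
      fix w assume "w \<in> loc_map sc p \<phi> 1 ` ?M"
      then obtain c s where "s \<notin> p" "w = loc_map sc p \<phi> 1 (frac sc p (sc c x) s)"
        by (auto elim: Mloc_cases)
      then show "w \<in> Rloc p" using map R.frac_in_Mloc by simp
    qed
    show "Rloc p \<subseteq> loc_map sc p \<phi> 1 ` ?M"
    proof
      fix w assume "w \<in> Rloc p"
      then obtain c s where w: "s \<notin> p" "w = frac (*) p c s" by (auto elim: R.Mloc_cases)
      have s: "s * \<phi> x \<notin> p" using w(1) \<phi>(2) by (rule notin_mult)
      have "w = frac (*) p (c * \<phi> x) (s * \<phi> x)" unfolding w(2)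
        using w(1) s one by (intro R.frac_eqI[of _ _ 1]) (simp_all add: mult_ac)
      then have "w = loc_map sc p \<phi> 1 (frac sc p (sc c x) (s * \<phi> x))" using map[OF s] by simp
      moreover have "frac sc p (sc c x) (s * \<phi> x) \<in> ?M" using s by (intro frac_in_Mloc) auto
      ultimately show "w \<in> loc_map sc p \<phi> 1 ` ?M" by blast
    qed
  qed
qed

text \<open>A splitting \<open>\<phi>/s\<close> has \<open>\<phi> x / s = 1\<close>, which keeps
  \<open>\<phi> x\<close> outside \<open>p\<close>. Conversely \<open>\<phi>\<close> divided by
  \<open>\<phi> x\<close> splits, and \<open>\<phi>\<close> itself identifies \<open>(Rx)_p\<close>
  with \<open>R_p\<close>.\<close>

lemma p_free_basic_iff: "p_free_basic sc p E x \<longleftrightarrow> (\<exists>\<phi>\<in>E. \<phi> x \<notin> p)"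
proof
  note one = prime_ideal_one[OF prime]
  assume "p_free_basic sc p E x"
  then obtain \<phi> s where \<phi>: "\<phi> \<in> E" "s \<notin> p" "loc_map sc p \<phi> s (frac sc p x 1) = loc_one p"
    unfolding p_free_basic_def Eloc_def by blast
  then have "frac (*) p (\<phi> x) s = frac (*) p 1 1"
    using loc_map_frac[OF \<phi>(1,2) one, of x] by (simp add: loc_one_def)
  then obtain u where "u \<notin> p" "u * (1 * \<phi> x) = u * (s * 1)"
    using R.frac_eqD[OF \<phi>(2) one] by blast
  then have "u * \<phi> x \<notin> p" using \<phi>(2) notin_mult by simp
  then show "\<exists>\<phi>\<in>E. \<phi> x \<notin> p" using \<phi>(1) prime_ideal_mult[OF prime] by blast
next
  note one = prime_ideal_one[OF prime]
  assume "\<exists>\<phi>\<in>E. \<phi> x \<notin> p"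
  then obtain \<phi> where \<phi>: "\<phi> \<in> E" "\<phi> x \<notin> p" by blast
  have "loc_map sc p \<phi> (\<phi> x) (frac sc p x 1) = frac (*) p (\<phi> x) (\<phi> x)"
    using loc_map_frac[OF \<phi> one] by simp
  also have "\<dots> = loc_one p" unfolding loc_one_def
    using \<phi>(2) one by (intro R.frac_eqI[of _ _ 1]) simp_all
  finally have "\<exists>\<psi>\<in>Eloc sc p E. \<psi> (frac sc p x 1) = loc_one p"
    using \<phi> unfolding Eloc_def by blast
  moreover have "Mloc sc p (range (\<lambda>r. sc r x)) \<subseteq> Mloc sc p UNIV" unfolding Mloc_def by blast
  ultimately show "p_free_basic sc p E x"
    unfolding p_free_basic_def using bij_betw_loc_map[OF \<phi>] loc_map_linear[OF \<phi>(1)] by blast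
qed

text \<open>The coordinates of the projection are fractions \<open>\<phi> i / s i\<close>, and the
  basis of \<open>F\<close> consists of fractions \<open>y j / t j\<close> with \<open>y j\<close>
  in \<open>N\<close>. Clearing denominators gives a dual family modulo \<open>p\<close>.\<close>

lemma rank_ge_free_E_summand:
  assumes FN: "F \<subseteq> Mloc sc p N" and free: "free_E_summand sc p E F n"
  shows "rank_ge E p n N"
proof -
  note one = prime_ideal_one[OF prime]
  obtain G \<psi> where F: "loc_submodule sc p F" and G: "loc_submodule sc p G" "F \<inter> G = {loc_zero sc p}"
    and bij: "bij_betw \<psi> F (Rpow p n)" and
    proj: "\<And>i. i < n \<Longrightarrow> (\<lambda>v. if v \<in> Mloc sc p UNIV then \<psi> (summand_proj sc p F G v) i else undefined)
        \<in> Eloc sc p E"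
    using free unfolding free_E_summand_def by blast
  have "\<exists>\<phi> s. \<phi> \<in> E \<and> s \<notin> p \<and> (\<forall>v\<in>F. loc_map sc p \<phi> s v = \<psi> v i)" if i: "i < n" for i
  proof -
    obtain \<phi> s where \<phi>: "\<phi> \<in> E" "s \<notin> p" and eq: "(\<lambda>v. if v \<in> Mloc sc p UNIV
        then \<psi> (summand_proj sc p F G v) i else undefined) = loc_map sc p \<phi> s"
      using proj[OF i] unfolding Eloc_def by blast
    have "loc_map sc p \<phi> s v = \<psi> v i" if "v \<in> F" for v
    proof -
      have "v \<in> Mloc sc p UNIV" using that F unfolding loc_submodule_def by blast
      then show ?thesis using fun_cong[OF eq, of v] summand_proj_self[OF F G that] by simp
    qed
    then show ?thesis using \<phi> by blast
  qed
  then obtain \<phi> s where \<phi>: "\<And>i. i < n \<Longrightarrow> \<phi> i \<in> E" "\<And>i. i < n \<Longrightarrow> s i \<notin> p"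
    "\<And>i v. i < n \<Longrightarrow> v \<in> F \<Longrightarrow> loc_map sc p (\<phi> i) (s i) v = \<psi> v i" by metis
  have "\<exists>y t. y \<in> N \<and> t \<notin> p \<and> frac sc p y t \<in> F \<and>
      (\<forall>i<n. \<psi> (frac sc p y t) i = frac (*) p (if i = j then 1 else 0) 1)" if "j < n" for j
  proof -
    let ?e = "\<lambda>i. frac (*) p (if i = j then 1 else 0) 1"
    \<comment> \<open>Beyond \<open>n\<close> the vector must be \<open>loc_zero\<close>, which is
      the fraction 0/1 of the else branch because \<open>j < n\<close>.\<close>
    have "?e \<in> Rpow p n" unfolding Rpow_def loc_zero_def using that one R.frac_in_Mloc by auto
    then obtain f where f: "f \<in> F" "\<psi> f = ?e" using bij unfolding bij_betw_def by (metis imageE)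
    obtain y t where "y \<in> N" "t \<notin> p" "f = frac sc p y t"
      using f(1) FN by (meson Mloc_cases subsetD)
    with f show ?thesis by (intro exI[of _ y] exI[of _ t]) simp
  qed
  then obtain y t where y: "\<And>j. j < n \<Longrightarrow> y j \<in> N" "\<And>j. j < n \<Longrightarrow> t j \<notin> p"
    "\<And>j. j < n \<Longrightarrow> frac sc p (y j) (t j) \<in> F"
    "\<And>i j. i < n \<Longrightarrow> j < n \<Longrightarrow> \<psi> (frac sc p (y j) (t j)) i = frac (*) p (if i = j then 1 else 0) 1"
    by metis
  have val: "\<phi> i (y j) \<in> p \<longleftrightarrow> i \<noteq> j" if "i < n" "j < n" for i j
  proof -
    let ?d = "if i = j then 1 else 0 :: 'r"
    have st: "s i * t j \<notin> p" using \<phi>(2) y(2) that by (intro notin_mult)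
    have "frac (*) p (\<phi> i (y j)) (s i * t j) = frac (*) p ?d 1"
      using loc_map_frac[OF \<phi>(1,2)[OF that(1)] y(2)[OF that(2)]] \<phi>(3)[OF that(1) y(3)[OF that(2)]]
        y(4)[OF that] by simp
    then obtain u where u: "u \<notin> p" "u * (1 * \<phi> i (y j)) = u * (s i * t j * ?d)"
      using R.frac_eqD[OF st one] by blast
    have "\<phi> i (y j) \<in> p \<longleftrightarrow> u * \<phi> i (y j) \<in> p" using u(1) prime_ideal_mult_iff[OF prime] by blast
    also have "\<dots> \<longleftrightarrow> i \<noteq> j"
      using u st notin_mult[OF u(1) st] prime_ideal_zero[OF prime] by auto
    finally show ?thesis .
  qed
  have "rank_ge E p (card {..<n}) N"
    by (rule rank_ge_dual_family[of _ \<phi> _ y]) (use \<phi>(1) y(1) val in auto)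
  then show ?thesis by simp
qed

end

text \<open>Prepending \<open>q\<close> to a chain from \<open>p\<close> lengthens it by one, and
  finiteness at \<open>q\<close> makes the inequality strict.\<close>

lemma dimX_strict_antimono:
  assumes "p \<in> X" "q \<in> X" "q \<subset> p" "dimX X q \<noteq> \<infinity>"
  shows "dimX X p < dimX X q"
proof -
  obtain m where m: "dimX X q = enat m" using assms(4) by auto
  have chain: "n < m" if c: "c 0 = p" "\<forall>i\<le>n. c i \<in> X" "\<forall>i<n. c i \<subset> c (Suc i)" for c n
  proof -
    let ?c = "\<lambda>i. case i of 0 \<Rightarrow> q | Suc j \<Rightarrow> c j"
    have "enat (Suc n) \<le> dimX X q" unfolding dimX_def
    proof (rule Sup_upper, clarify, intro exI conjI allI impI)
      show "enat (Suc n) = enat (Suc n)" ..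
      show "?c 0 = q" by simp
      show "?c i \<in> X" if "i \<le> Suc n" for i using that c(2) assms(2) by (cases i) auto
      show "?c i \<subset> ?c (Suc i)" if "i < Suc n" for i using that c(1,3) assms(3) by (cases i) auto
    qed
    then show ?thesis using m by simp
  qed
  \<comment> \<open>The chain of length 0 at \<open>p\<close> shows that \<open>m - 1\<close> is not
    truncated.\<close>
  have "0 < m" by (rule chain[of "\<lambda>_. p"]) (use assms in auto)
  have "dimX X p \<le> enat (m - 1)" unfolding dimX_def
  proof (rule Sup_least, clarify)
    fix n c assume "p = c 0" "\<forall>i\<le>n. c i \<in> X" "\<forall>i<n. c i \<subset> c (Suc i)"
    then have "n < m" by (intro chain) auto
    then show "enat n \<le> enat (m - 1)" by simp
  qed
  also have "\<dots> < enat m" using \<open>0 < m\<close> by simp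
  finally show ?thesis using m by simp
qed

theorem theorem4p5:
  fixes sc :: "'r::comm_ring_1 \<Rightarrow> 'm::ab_group_add \<Rightarrow> 'm"
    and N :: "'m set" and X :: "'r set set" and E :: "('m \<Rightarrow> 'r) set"
  assumes noeth: "noetherian_ring TYPE('r)"
    and modM: "module sc"
    and fgM: "\<exists>S. finite S \<and> module.span sc S = UNIV"
    and subN: "module.subspace sc N"
    and fgN: "\<exists>S. finite S \<and> S \<subseteq> N \<and> module.span sc S = N"
    and basic: "basic_set X"
    and homE: "hom_submodule sc E"
    and hyp: "\<forall>p\<in>X. \<exists>F n. F \<subseteq> Mloc sc p N \<and> 1 + dimX X p \<le> enat n \<and> free_E_summand sc p E F n"
  shows "(\<exists>x\<in>N. X_free_basic sc X E x) \<and>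
         (\<forall>a y. y \<in> N \<and> X_free_basic (sum_scale sc) X (sum_E E) (a, y) \<longrightarrow>
             (\<exists>z\<in>N. X_free_basic sc X E (y + sc a z)))"
proof -
  interpret module_functionals sc E
    using modM homE unfolding module_functionals_def module_functionals_axioms_def hom_submodule_def
    by blast
  have X: "prime_ideal p" if "p \<in> X" for p
    using basic that unfolding basic_set_def Spec_def by blast
  have closed: "\<Inter>Z \<in> X" if "Z \<subseteq> X" "prime_ideal (\<Inter>Z)" for Z
    using basic that unfolding basic_set_def Spec_def by blast
  have loc: "localized_functionals sc E p" if "p \<in> X" for p
    using X[OF that] module_functionals_axioms modM
    by (simp add: localized_functionals_def localization_def localization_axioms_def)
  have fb: "X_free_basic sc X E x \<longleftrightarrow> (\<forall>p\<in>X. \<exists>\<phi>\<in>E. \<phi> x \<notin> p)" for x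
    unfolding X_free_basic_def using localized_functionals.p_free_basic_iff[OF loc] by blast
  \<comment> \<open>The hypothesis bounds \<open>dimX\<close> by a finite rank, so
    \<open>the_enat\<close> is applied to finite values on \<open>X\<close>.\<close>
  define d where "d p = the_enat (1 + dimX X p)" for p
  have fin: "dimX X p \<noteq> \<infinity>" if p: "p \<in> X" for p
  proof -
    obtain n where "1 + dimX X p \<le> enat n" using hyp[THEN bspec, OF p] by (elim exE conjE) simp
    then show ?thesis by (cases "dimX X p") auto
  qed
  have d_eq: "enat (d p) = 1 + dimX X p" if "p \<in> X" for p
    unfolding d_def using fin[OF that] by (auto simp: one_enat_def)
  have d: "d p < d q" if "p \<in> X" "q \<in> X" "q \<subset> p" for p q
  proof -
    have "enat (d p) < enat (d q)"
      unfolding d_eq[OF that(1)] d_eq[OF that(2)]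
      using dimX_strict_antimono[OF that fin[OF that(2)]] fin[OF that(1)]
      by (cases "dimX X p"; cases "dimX X q") (auto simp: one_enat_def)
    then show ?thesis by simp
  qed
  have pos: "0 < d p" if "p \<in> X" for p
    using d_eq[OF that] fin[OF that] by (cases "dimX X p") (auto simp: one_enat_def)
  have rank: "rank_ge E p (d p) N" if p: "p \<in> X" for p
  proof -
    obtain F n where F: "F \<subseteq> Mloc sc p N" "1 + dimX X p \<le> enat n" "free_E_summand sc p E F n"
      using hyp[THEN bspec, OF p] by (elim exE conjE)
    have "d p \<le> n" using F(2) d_eq[OF p] by (metis enat_ord_simps(1))
    then show ?thesis
      by (rule rank_ge_antimono[OF localized_functionals.rank_ge_free_E_summand[OF loc[OF p] F(1,3)]])
  qed
  obtain S where S: "finite S" "span S = N" using fgN by blast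
  obtain k and h :: "nat \<Rightarrow> 'm" where h: "S = h ` {i. i < k}"
    using finite_imp_nat_seg_image_inj_on[OF S(1)] by blast
  have main: "\<exists>z\<in>N. X_free_basic sc X E (y + sc a z)"
    if y: "y \<in> N" and a: "\<And>p. p \<in> X \<Longrightarrow> a \<notin> p \<or> (\<exists>\<phi>\<in>E. \<phi> y \<notin> p)" for a y
  proof -
    \<comment> \<open>\<open>y\<close> takes index 0 and the \<open>k\<close> generators of
      \<open>N\<close> follow, so the family has \<open>k + 1\<close> members.\<close>
    define x where "x i = (case i of 0 \<Rightarrow> y | Suc j \<Rightarrow> h j)" for i
    have xN: "x i \<in> N" if "i \<le> k" for i
      using that y S(2) h by (cases i) (auto simp: x_def intro: span_base)
    have "S \<subseteq> lincombs x {..k}"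
    proof
      fix v assume "v \<in> S"
      then obtain i where "i < k" "v = x (Suc i)" using h by (auto simp: x_def)
      then show "v \<in> lincombs x {..k}" using lincombs_base[of "{..k}" "Suc i" x] by simp
    qed
    then have "N \<subseteq> lincombs x {..k}" using span_minimal[OF _ subspace_lincombs] S(2) by blast
    then have "rank_ge E p (min (Suc k) (d p)) (lincombs x {..k})" if "p \<in> X" for p
      using rank_ge_mono[OF rank_ge_antimono[OF rank[OF that]]] by simp
    then have "\<exists>z\<in>N. \<forall>p\<in>X. \<exists>\<phi>\<in>E. \<phi> (x 0 + sc a z) \<notin> p"
      by (rule exists_nonvanishing[OF noeth X closed d pos subN xN, rotated -1])
        (use a in \<open>simp_all add: x_def\<close>)
    then show ?thesis unfolding fb by (simp add: x_def)
  qed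
  show ?thesis
  proof (intro conjI allI impI)
    \<comment> \<open>With \<open>a = 1\<close> and \<open>y = 0\<close> the condition on
      \<open>a\<close> holds because no prime contains 1.\<close>
    have "\<exists>z\<in>N. X_free_basic sc X E (0 + sc 1 z)"
      using subspace_0[OF subN] prime_ideal_one X by (intro main) auto
    then show "\<exists>x\<in>N. X_free_basic sc X E x" by simp
  next
    fix a y assume ay: "y \<in> N \<and> X_free_basic (sum_scale sc) X (sum_E E) (a, y)"
    have "module (sum_scale sc)"
      by unfold_locales
        (auto simp: sum_scale_def prod_eq_iff scale_right_distrib scale_left_distrib algebra_simps)
    moreover have "r_hom (sum_scale sc) \<phi>" if "\<phi> \<in> sum_E E" for \<phi>
      using that unfolding sum_E_def r_hom_def
      by (auto simp: sum_scale_def E_add E_scale algebra_simps)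
    ultimately have sum_loc: "localized_functionals (sum_scale sc) (sum_E E) p" if "p \<in> X" for p
      using X[OF that] by (simp add: localized_functionals_def module_functionals_def
        module_functionals_axioms_def localization_def localization_axioms_def)
    \<comment> \<open>If \<open>a\<close> and all values \<open>\<phi> y\<close> lay in
      \<open>p\<close>, so would every value \<open>c * a + \<phi> y\<close> of a functional in
      \<open>sum_E E\<close>.\<close>
    have "a \<notin> p \<or> (\<exists>\<phi>\<in>E. \<phi> y \<notin> p)" if p: "p \<in> X" for p
    proof -
      have "p_free_basic (sum_scale sc) p (sum_E E) (a, y)"
        using ay p unfolding X_free_basic_def by blast
      then obtain c \<phi> where "\<phi> \<in> E" "c * a + \<phi> y \<notin> p"
        unfolding localized_functionals.p_free_basic_iff[OF sum_loc[OF p]] by (auto simp: sum_E_def)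
      then show ?thesis using prime_ideal_add[OF X[OF p]] prime_ideal_mult[OF X[OF p]] by blast
    qed
    then show "\<exists>z\<in>N. X_free_basic sc X E (y + sc a z)" using main ay by blast
  qed
qed

end
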